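(* Consider the wave kinetic hierarchy in dimension $d=3$. Let $T>0$, $p>1$, $q>3$, $\alpha,\beta>0$, and let $\mu\in\mathbb R$ be such that $e^{2\mu}>32\,C_{p,q,\alpha,\beta}$, where $$C_{p,q,\alpha,\beta}=\frac{16\,p\,\pi^3}{\alpha(p-1)}\left(\frac13+\frac1{q-3}\right)\max\{\beta^q,\beta^{-3q}\}.$$ Let $F_0=(f_0^{(k)})_{k=1}^\infty\in\mathcal X^\infty_{p,q,\alpha,\beta,\mu}$, and let $F=(f^{(k)})_{k=1}^\infty$ be a mild $\mu$-solution in $[0,T]$ to the wave kinetic hierarchy corresponding to the initial data $F_0$. Then $F$ is unique; that is, any two mild $\mu$-solutions in $[0,T]$ corresponding to the same initial data $F_0$ coincide.
   Context: Notation: $X_k=(x_1,\dots,x_k)$, $V_k=(v_1,\dots,v_k)\in\mathbb R^{3k}$; $\langle y\rangle=\sqrt{1+|y|^2}$ for $y\in\mathbb R^3$; $\langle\langle Y_k\rangle\rangle=\prod_{i=1}^k\langle y_i\rangle$. Spaces: $X^k_{p,q,\alpha,\beta}$ is the space of measurable $g^{(k)}:\mathbb R^{3k}\times\mathbb R^{3k}\to\mathbb R$ that are symmetric (invariant under all permutations of the pairs $(x_i,v_i)$, $i=1,\dots,k$) with $\|g^{(k)}\|_{k,p,q,\alpha,\beta}:=\sup_{X_k,V_k}\langle\langle\alpha X_k\rangle\rangle^p\langle\langle\beta V_k\rangle\rangle^q|g^{(k)}(X_k,V_k)|<\infty$. $\mathcal X^\infty_{p,q,\alpha,\beta,\mu}$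 is the space of sequences $G=(g^{(k)})_{k\ge1}\in\prod_kX^k_{p,q,\alpha,\beta}$ with $\|G\|_{p,q,\alpha,\beta,\mu}:=\sup_{k}e^{\mu k}\|g^{(k)}\|_{k,p,q,\alpha,\beta}<\infty$. $\mathcal X^\infty_{p,q,\alpha,\beta,\mu,T}:=C([0,T],\mathcal X^\infty_{p,q,\alpha,\beta,\mu})$ with the supremum-in-time norm. Transport: $T_k^sg^{(k)}(t,X_k,V_k):=g^{(k)}(t,X_k-sV_k,V_k)$, and $\mathcal T^{-(\cdot)}F(\cdot):=(T_k^{-(\cdot)}f^{(k)}(\cdot))_{k\ge1}$, where $T_k^{-(\cdot)}f^{(k)}(\cdot)$ is the map $t\mapsto T_k^{-t}f^{(k)}(t)$. Collision operators: $\mathfrak C^{k+2}=\sum_{j=1}^k\mathfrak C_{j,k+2}$, $\mathfrak C_{j,k+2}=\mathfrak C^{L_0}_{j,k+2}+\mathfrak C^{L_1}_{j,k+2}-\mathfrak C^{L_2}_{j,k+2}-\mathfrak C^{L_3}_{j,k+2}$, where each $\mathfrak C^{L_i}_{j,k+2}f^{(k+2)}(t,X_k,V_k)$ equals $$\int_{\mathbb R^9}dv_{k+1}dv_{k+2}dv_{k+3}\,\delta(\Sigma_{j,k+2})\delta(\Omega_{j,k+2})\,f^{(k+2)}(t,X_k,x_j,x_j;\,W_i)$$ with velocity arguments $W_0=(V_k^{j,v_{k+1}},v_{k+2},v_{k+3})$, $W_1=(V_k,v_{k+2},v_{k+3})$, $W_2=(V_k,v_{k+1},v_{k+3})$, $W_3=(V_k,v_{k+1},v_{k+2})$.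 Here $V_k^{j,v_{k+1}}$ is $V_k$ with its $j$-th entry replaced by $v_{k+1}$, $\Sigma_{j,k+2}=v_j+v_{k+1}-v_{k+2}-v_{k+3}$, $\Omega_{j,k+2}=|v_j|^2+|v_{k+1}|^2-|v_{k+2}|^2-|v_{k+3}|^2$. The delta-integrals are given explicitly (with $v=v_j$ and $(v_{k+1},v_{k+2},v_{k+3})$ in the role of $(v_1,v_2,v_3)$) by $$\int_{\mathbb R^9}\delta(\Sigma)\delta(\Omega)F(v_1,v_2,v_3)\,dv_1dv_2dv_3=\frac18\int_{\mathbb R^3\times\mathbb S^2}|v-v_1|F\Big(v_1,\tfrac{v+v_1}2+\tfrac{|v-v_1|}2\sigma,\tfrac{v+v_1}2-\tfrac{|v-v_1|}2\sigma\Big)d\sigma\,dv_1.$$ Wave kinetic hierarchy: $\partial_tf^{(k)}+\sum_{j=1}^kv_j\cdot\nabla_{x_j}f^{(k)}=\mathfrak C^{k+2}f^{(k+2)}$, $k\in\mathbb N$. Mild $\mu$-solution in $[0,T]$ with initial data $F_0=(f_0^{(k)})\in\mathcal X^\infty_{p,q,\alpha,\beta,\mu}$: a sequence $F=(f^{(k)})_{k\ge1}$ of measurable functions $f^{(k)}:[0,T]\times\mathbb R^{3k}\times\mathbb R^{3k}\to\mathbb R$ with $\mathcal T^{-(\cdot)}F(\cdot)\in\mathcal X^\infty_{p,q,\alpha,\beta,\mu,T}$ and $$T_k^{-t}f^{(k)}(t)=f_0^{(k)}+\int_0^tT_k^{-s}\mathfrak C^{k+2}f^{(k+2)}(s)\,ds\quad\forall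 t\in[0,T],\ \forall k\in\mathbb N.$$ *)

theory Defs
  imports "HOL-Analysis.Analysis" "HOL-Combinatorics.Permutations"
begin

section \<open>Phase space\<close>

text \<open>
  A point of \<open>\<real>\<^sup>3\<^sup>k\<close> is an extensional function from \<open>{1..k}\<close> to \<open>\<real>\<^sup>3\<close>, i.e. an element of
  \<open>space (conf k)\<close>, where \<open>conf k\<close> is \<open>\<real>\<^sup>3\<^sup>k\<close> with its Borel sigma-algebra. Functions of \<open>(X, V)\<close> are
  only ever looked at on \<open>space (conf k) \<times> space (conf k)\<close>. Functions and norms are pointwise:
  there are no equivalence classes modulo null sets.
\<close>

type_synonym vec3 = "real ^ 3"
type_synonym config = "nat \<Rightarrow> vec3"
type_synonym phase_fun = "config \<Rightarrow> config \<Rightarrow> real"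

definition conf :: "nat \<Rightarrow> config measure" where
  "conf k = Pi\<^sub>M {1..k} (\<lambda>_. borel)"

definition jap :: "vec3 \<Rightarrow> real" where
  "jap y = sqrt (1 + (norm y)\<^sup>2)"

definition japs :: "nat \<Rightarrow> config \<Rightarrow> real" where
  "japs k Y = (\<Prod>i=1..k. jap (Y i))"


section \<open>Function spaces\<close>

definition symmetric_fun :: "nat \<Rightarrow> phase_fun \<Rightarrow> bool" where
  "symmetric_fun k g \<longleftrightarrow>
     (\<forall>\<pi>. \<pi> permutes {1..k} \<longrightarrow>
       (\<forall>X\<in>space (conf k). \<forall>V\<in>space (conf k). g (X \<circ> \<pi>) (V \<circ> \<pi>) = g X V))"

definition X_norm :: "nat \<Rightarrow> real \<Rightarrow> real \<Rightarrow> real \<Rightarrow> real \<Rightarrow> phase_fun \<Rightarrow> ennreal" where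
  "X_norm k p q \<alpha> \<beta> g =
     (SUP X\<in>space (conf k). SUP V\<in>space (conf k).
        ennreal (japs k (\<lambda>i. \<alpha> *\<^sub>R X i) powr p * japs k (\<lambda>i. \<beta> *\<^sub>R V i) powr q * \<bar>g X V\<bar>))"

definition X_space :: "nat \<Rightarrow> real \<Rightarrow> real \<Rightarrow> real \<Rightarrow> real \<Rightarrow> phase_fun set" where
  "X_space k p q \<alpha> \<beta> =
     {g. (\<lambda>(X, V). g X V) \<in> borel_measurable (conf k \<Otimes>\<^sub>M conf k) \<and>
         symmetric_fun k g \<and> X_norm k p q \<alpha> \<beta> g < \<infinity>}"

text \<open>A sequence \<open>(g\<^sup>(\<^sup>k\<^sup>))\<close>, \<open>k \<ge> 1\<close>, is a function on \<open>nat\<close> whose value at \<open>0\<close> is ignored.\<close>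

type_synonym hierarchy = "nat \<Rightarrow> phase_fun"

definition XX_norm :: "real \<Rightarrow> real \<Rightarrow> real \<Rightarrow> real \<Rightarrow> real \<Rightarrow> hierarchy \<Rightarrow> ennreal" where
  "XX_norm p q \<alpha> \<beta> \<mu> G = (SUP k\<in>{1..}. ennreal (exp (\<mu> * real k)) * X_norm k p q \<alpha> \<beta> (G k))"

definition XX_space :: "real \<Rightarrow> real \<Rightarrow> real \<Rightarrow> real \<Rightarrow> real \<Rightarrow> hierarchy set" where
  "XX_space p q \<alpha> \<beta> \<mu> =
     {G. (\<forall>k\<ge>1. G k \<in> X_space k p q \<alpha> \<beta>) \<and> XX_norm p q \<alpha> \<beta> \<mu> G < \<infinity>}"

text \<open>
  \<open>C([0,T], XX_space)\<close>: norm continuity at every time. The supremum-in-time norm of such a curve is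
  finite by compactness of \<open>[0,T]\<close> and needs no separate condition.
\<close>

definition XXT_space ::
  "real \<Rightarrow> real \<Rightarrow> real \<Rightarrow> real \<Rightarrow> real \<Rightarrow> real \<Rightarrow> (real \<Rightarrow> hierarchy) set" where
  "XXT_space p q \<alpha> \<beta> \<mu> T =
     {G. (\<forall>t\<in>{0..T}. G t \<in> XX_space p q \<alpha> \<beta> \<mu>) \<and>
         (\<forall>t\<in>{0..T}. ((\<lambda>s. XX_norm p q \<alpha> \<beta> \<mu> (\<lambda>k X V. G s k X V - G t k X V)) \<longlongrightarrow> 0)
                        (at t within {0..T}))}"


section \<open>Transport\<close>

definition transport :: "nat \<Rightarrow> real \<Rightarrow> phase_fun \<Rightarrow> phase_fun" where
  "transport k s g = (\<lambda>X V. g (\<lambda>i\<in>{1..k}. X i - s *\<^sub>R V i) V)"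


section \<open>Surface measure on the unit sphere\<close>

text \<open>
  The surface measure of \<open>A \<subseteq> S\<^sup>2\<close> is \<open>3\<close> times the Lebesgue measure of the cone
  \<open>{r a | 0 < r < 1, a \<in> A}\<close>; here \<open>sgn x = x / norm x\<close>. It is a measure on all of \<open>\<real>\<^sup>3\<close>, carried by
  the unit sphere.
\<close>

definition sphere_measure :: "vec3 measure" where
  "sphere_measure = scale_measure 3 (distr (restrict_space lborel (ball 0 1)) borel sgn)"

lemma borel_measurable_sgn_vec3: "(sgn :: vec3 \<Rightarrow> vec3) \<in> borel_measurable borel"
proof -
  have "(\<lambda>x::vec3. inverse (norm x) *\<^sub>R x) \<in> borel_measurable borel"
    by measurable
  then show ?thesis
    by (simp add: sgn_div_norm[abs_def] divide_inverse)
qed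

lemma sets_sphere_measure [simp, measurable_cong]: "sets sphere_measure = sets borel"
  by (simp add: sphere_measure_def)

lemma space_sphere_measure [simp]: "space sphere_measure = UNIV"
  by (simp add: sphere_measure_def space_scale_measure)

lemma emeasure_sphere_measure:
  assumes A: "A \<in> sets borel"
  shows "emeasure sphere_measure A = 3 * emeasure lborel {x \<in> ball 0 1. sgn x \<in> A}"
proof -
  have m: "(sgn :: vec3 \<Rightarrow> vec3) \<in> measurable (restrict_space lborel (ball 0 1)) borel"
    by (intro measurable_restrict_space1) (simp add: borel_measurable_sgn_vec3)
  have *: "sgn -` A \<inter> space (restrict_space lborel (ball 0 1)) = {x \<in> ball 0 1. sgn x \<in> A}"
    by (auto simp: space_restrict_space)
  show ?thesis
    unfolding sphere_measure_def
    using A m by (simp add: emeasure_distr * emeasure_restrict_space del: mem_ball) (auto intro!: arg_cong[where f = "\<lambda>B. 3 * emeasure lborel B"])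
qed

lemma emeasure_sphere_measure_UNIV: "emeasure sphere_measure UNIV = ennreal (4 * pi)"
proof -
  have "emeasure sphere_measure UNIV = 3 * emeasure lborel (ball (0::vec3) 1)"
    by (simp add: emeasure_sphere_measure ball_def)
  also have "\<dots> = 3 * ennreal (4 / 3 * pi)"
    by (simp add: emeasure_ball unit_ball_vol_numeral eval_unit_ball_vol)
  also have "\<dots> = ennreal (3 * (4 / 3 * pi))"
    by (subst ennreal_mult') auto
  finally show ?thesis by simp
qed

lemma AE_sphere_measure: "AE \<sigma> in sphere_measure. norm \<sigma> = 1"
proof (rule AE_I)
  have "{x \<in> ball (0::vec3) 1. sgn x \<in> - sphere 0 1} = {0}"
    by (auto simp: norm_sgn)
  then have "emeasure sphere_measure (- sphere 0 1) = 0"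
    by (subst emeasure_sphere_measure) auto
  then show "emeasure sphere_measure (- sphere 0 1) = 0" .
qed auto


section \<open>Collision operators\<close>

text \<open>
  \<open>delta_integral v F\<close> is the integral of \<open>F v\<^sub>1 v\<^sub>2 v\<^sub>3\<close> against \<open>\<delta>(\<Sigma>) \<delta>(\<Omega>)\<close> over \<open>\<real>\<^sup>9\<close>, through its
  explicit parametrisation by \<open>\<real>\<^sup>3 \<times> S\<^sup>2\<close>.
\<close>

definition delta_integral :: "vec3 \<Rightarrow> (vec3 \<Rightarrow> vec3 \<Rightarrow> vec3 \<Rightarrow> real) \<Rightarrow> real" where
  "delta_integral v F =
     1 / 8 * (\<integral>(v1, \<sigma>). norm (v - v1) *
                F v1 ((1 / 2) *\<^sub>R (v + v1) + (norm (v - v1) / 2) *\<^sub>R \<sigma>)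
                     ((1 / 2) *\<^sub>R (v + v1) - (norm (v - v1) / 2) *\<^sub>R \<sigma>)
              \<partial>(lborel \<Otimes>\<^sub>M sphere_measure))"

definition ext_pos :: "nat \<Rightarrow> nat \<Rightarrow> config \<Rightarrow> config" where
  "ext_pos j k X = X(k + 1 := X j, k + 2 := X j)"

definition coll_L0 :: "nat \<Rightarrow> nat \<Rightarrow> phase_fun \<Rightarrow> phase_fun" where
  "coll_L0 j k f = (\<lambda>X V. delta_integral (V j)
     (\<lambda>v1 v2 v3. f (ext_pos j k X) (V(j := v1, k + 1 := v2, k + 2 := v3))))"

definition coll_L1 :: "nat \<Rightarrow> nat \<Rightarrow> phase_fun \<Rightarrow> phase_fun" where
  "coll_L1 j k f = (\<lambda>X V. delta_integral (V j)
     (\<lambda>v1 v2 v3. f (ext_pos j k X) (V(k + 1 := v2, k + 2 := v3))))"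

definition coll_L2 :: "nat \<Rightarrow> nat \<Rightarrow> phase_fun \<Rightarrow> phase_fun" where
  "coll_L2 j k f = (\<lambda>X V. delta_integral (V j)
     (\<lambda>v1 v2 v3. f (ext_pos j k X) (V(k + 1 := v1, k + 2 := v3))))"

definition coll_L3 :: "nat \<Rightarrow> nat \<Rightarrow> phase_fun \<Rightarrow> phase_fun" where
  "coll_L3 j k f = (\<lambda>X V. delta_integral (V j)
     (\<lambda>v1 v2 v3. f (ext_pos j k X) (V(k + 1 := v1, k + 2 := v2))))"

text \<open>\<open>collision k\<close> is the operator \<open>C\<^sup>k\<^sup>+\<^sup>2\<close>, taking functions of \<open>k + 2\<close> particles to functions of \<open>k\<close>.\<close>

definition collision :: "nat \<Rightarrow> phase_fun \<Rightarrow> phase_fun" where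
  "collision k f = (\<lambda>X V. \<Sum>j=1..k.
     coll_L0 j k f X V + coll_L1 j k f X V - coll_L2 j k f X V - coll_L3 j k f X V)"


section \<open>Mild solutions of the wave kinetic hierarchy\<close>

text \<open>The Duhamel identity is read pointwise in \<open>(X, V)\<close>, with a Lebesgue integral in time.\<close>

definition mild_solution ::
  "real \<Rightarrow> real \<Rightarrow> real \<Rightarrow> real \<Rightarrow> real \<Rightarrow> real \<Rightarrow> hierarchy \<Rightarrow> (real \<Rightarrow> hierarchy) \<Rightarrow> bool" where
  "mild_solution p q \<alpha> \<beta> \<mu> T F0 F \<longleftrightarrow>
     (\<forall>k\<ge>1. (\<lambda>(t, X, V). F t k X V) \<in>
        borel_measurable (restrict_space borel {0..T} \<Otimes>\<^sub>M (conf k \<Otimes>\<^sub>M conf k))) \<and>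
     (\<lambda>t k. transport k (- t) (F t k)) \<in> XXT_space p q \<alpha> \<beta> \<mu> T \<and>
     (\<forall>t\<in>{0..T}. \<forall>k\<ge>1. \<forall>X\<in>space (conf k). \<forall>V\<in>space (conf k).
        transport k (- t) (F t k) X V =
          F0 k X V +
          (LINT s:{0..t}|lborel. transport k (- s) (collision k (F s (k + 2))) X V))"

definition C_const :: "real \<Rightarrow> real \<Rightarrow> real \<Rightarrow> real \<Rightarrow> real" where
  "C_const p q \<alpha> \<beta> =
     16 * p * pi ^ 3 / (\<alpha> * (p - 1)) * (1 / 3 + 1 / (q - 3)) *
     max (\<beta> powr q) (\<beta> powr (- 3 * q))"

end

theory Submission
  imports Defs
begin

text \<open>
  In the frame moving with free transport, the difference of two solutions with the same data obeys a
  Duhamel inequality without source: its level \<open>k\<close> is at most a time integral of a sum over the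
  particles \<open>j \<le> k\<close> and the four collision terms, each evaluated on level \<open>k + 2\<close>. The weight
  \<open>\<phi>(x, v) = \<langle>\<alpha> x\<rangle>\<^sup>-\<^sup>p \<langle>\<beta> v\<rangle>\<^sup>-\<^sup>q\<close> is adapted to one collision: the rate at which collisions feed three
  copies of \<open>\<phi>\<close> into one phase point \<open>(x, v)\<close> has a time integral of at most \<open>C \<phi>(x, v)\<close>
  (\<open>nn_integral_rate_le\<close>), because two particles with relative velocity \<open>w\<close> stay close only for a time
  of order \<open>1 / |w|\<close>, which cancels the collision kernel \<open>|w|\<close>.

  Iterating this bound term by term is useless: the sum over \<open>j\<close> costs factors \<open>k\<close>, \<open>k + 2\<close>, \<open>k + 4\<close>, \<dots>,
  whose product grows like a factorial. The cure is to compare with tensor powers of a function that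
  moves in time. With \<open>\<rho> = e\<^sup>-\<^sup>\<mu>\<close> put
    \<open>U(t) = 2 \<rho> \<phi> + 27 \<rho>\<^sup>3 \<integral>\<^sub>0\<^sup>t rate\<close>.
  As \<open>27 \<rho>\<^sup>2 C \<le> 1\<close>, one has \<open>U \<le> 3 \<rho> \<phi>\<close>, so that the collision integral of three copies of \<open>U\<close> is at
  most \<open>27 \<rho>\<^sup>3\<close> times the rate, that is, at most the time derivative of \<open>U\<close>. By the Leibniz rule the
  sum over \<open>j\<close> in the Duhamel inequality, applied to the powers \<open>U\<^sup>\<otimes>\<^sup>(\<^sup>k\<^sup>+\<^sup>2\<^sup>)\<close>, is at most the derivative
  of \<open>U\<^sup>\<otimes>\<^sup>k\<close>: these powers solve the inequality in the reverse direction, with no combinatorial loss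
  (\<open>majorant_supersolution\<close>).

  The difference is bounded at level \<open>k\<close> by \<open>M \<rho>\<^sup>k \<phi>\<^sup>\<otimes>\<^sup>k\<close>, hence by \<open>M 2\<^sup>-\<^sup>k U\<^sup>\<otimes>\<^sup>k\<close>. Inserting the bound of
  level \<open>k + 2\<close> into the Duhamel inequality improves that of level \<open>k\<close> by the factor \<open>1 / 4\<close>, and
  repeating this shows that the difference vanishes (\<open>dominated_hierarchy_vanishes\<close>).
\<close>

section \<open>Dispersive and velocity integrals\<close>

text \<open>
  Layer cake: \<open>\<langle>N\<rangle>\<^sup>-\<^sup>q > t\<close> forces \<open>t < 1\<close> and \<open>N < t\<^sup>-\<^sup>1\<^sup>/\<^sup>q\<close>, so a volume bound \<open>c r\<^sup>d\<close> on the sublevel sets of \<open>N\<close>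
  turns the integral into \<open>c \<integral>\<^sub>0\<^sup>1 t\<^sup>-\<^sup>d\<^sup>/\<^sup>q dt\<close>. It serves with \<open>d = 3\<close> for velocities and with \<open>d = 1\<close> for times.
\<close>

lemma nn_integral_bracket_powr_le:
  fixes N :: "'a \<Rightarrow> real"
  assumes "sigma_finite_measure M" and N[measurable]: "N \<in> borel_measurable M"
    and N0: "\<And>x. N x \<ge> 0" and d: "d > 0" "q > d" and c: "c \<ge> 0"
    and vol: "\<And>r. r > 0 \<Longrightarrow> emeasure M {x \<in> space M. N x < r} \<le> ennreal (c * r powr d)"
  shows "(\<integral>\<^sup>+x. ennreal (sqrt (1 + (N x)\<^sup>2) powr - q) \<partial>M) \<le> ennreal (c * q / (q - d))"
proof -
  interpret M: sigma_finite_measure M by fact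
  interpret P: pair_sigma_finite M "lborel :: real measure" ..
  define f where "f x = sqrt (1 + (N x)\<^sup>2) powr - q" for x
  have f[measurable]: "f \<in> borel_measurable M" unfolding f_def by measurable
  have fpos: "f x > 0" for x
  proof -
    have "1 + (N x)\<^sup>2 > 0" by (rule add_pos_nonneg) auto
    then show ?thesis by (simp add: f_def)
  qed
  have ind: "indicator {0<..<f x} t \<le> (indicator {x \<in> space M. N x < t powr (- 1 / q)} x * indicator {0..1} t :: ennreal)"
    if x: "x \<in> space M" for x t
  proof (cases "0 < t \<and> t < f x")
    case True
    let ?r = "sqrt (1 + (N x)\<^sup>2)"
    have r1: "?r \<ge> 1" by simp
    have "f x \<le> 1 powr - q" unfolding f_def using r1 d by (intro powr_mono2') auto
    then have "t \<le> 1" using True by simp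
    have "(?r powr - q) powr (- 1 / q) < t powr (- 1 / q)"
      using True d by (intro powr_less_mono2_neg) (auto simp: f_def)
    then have "?r < t powr (- 1 / q)" using d r1 by (simp add: powr_powr)
    moreover have "N x \<le> ?r" by (rule real_le_rsqrt) simp
    ultimately show ?thesis using x True \<open>t \<le> 1\<close> by auto
  qed auto
  have "(\<integral>\<^sup>+x. ennreal (f x) \<partial>M) = (\<integral>\<^sup>+x. (\<integral>\<^sup>+t. indicator {0<..<f x} t \<partial>lborel) \<partial>M)"
    using fpos by (intro nn_integral_cong) (simp add: less_imp_le)
  also have "\<dots> \<le> (\<integral>\<^sup>+x. (\<integral>\<^sup>+t. indicator {x \<in> space M. N x < t powr (- 1 / q)} x * indicator {0..1} t \<partial>lborel) \<partial>M)"
    by (intro nn_integral_mono ind)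
  also have "\<dots> = (\<integral>\<^sup>+t. (\<integral>\<^sup>+x. indicator {x \<in> space M. N x < t powr (- 1 / q)} x * indicator {0..1} t \<partial>M) \<partial>lborel)"
    by (rule P.Fubini'[symmetric]) (unfold indicator_def, measurable)
  also have "\<dots> = (\<integral>\<^sup>+t. emeasure M {x \<in> space M. N x < t powr (- 1 / q)} * indicator {0..1} t \<partial>lborel)"
    by (intro nn_integral_cong) (simp add: nn_integral_multc)
  also have "\<dots> \<le> (\<integral>\<^sup>+t. ennreal (c * t powr (- d / q)) * indicator {0..1} t \<partial>lborel)"
  proof (rule nn_integral_mono_AE)
    have "AE t in lborel. t \<noteq> (0::real)" by (rule AE_lborel_singleton)
    then show "AE t in lborel. emeasure M {x \<in> space M. N x < t powr (- 1 / q)} * indicator {0..1} t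
      \<le> ennreal (c * t powr (- d / q)) * indicator {0..1} t"
    proof eventually_elim
      case (elim t)
      have "emeasure M {x \<in> space M. N x < t powr (- 1 / q)} \<le> ennreal (c * t powr (- d / q))" if "t > 0"
        using vol[of "t powr (- 1 / q)"] that by (simp add: powr_powr)
      then show ?case using elim by (auto simp: indicator_def)
    qed
  qed
  also have "\<dots> = ennreal (c * (1 powr (- d / q + 1) / (- d / q + 1)))"
    using d c by (intro nn_integral_has_integral_lebesgue' has_integral_mult_right has_integral_powr_from_0)
      (auto simp: field_simps)
  also have "c * (1 powr (- d / q + 1) / (- d / q + 1)) = c * q / (q - d)"
    using d by (simp add: field_simps)
  finally show ?thesis by (simp add: f_def)
qed

lemma jap_ge_1: "jap y \<ge> 1" by (simp add: jap_def)

lemma jap_pos[simp]: "jap y > 0" using jap_ge_1[of y] by linarith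

lemma borel_measurable_jap[measurable]: "jap \<in> borel_measurable borel"
  unfolding jap_def[abs_def] by measurable

lemma velocity_integral_le:
  assumes "q > 3" "\<beta> > 0"
  shows "(\<integral>\<^sup>+v. ennreal (jap (\<beta> *\<^sub>R v) powr - q) \<partial>lborel) \<le> ennreal (4 * pi / (3 * \<beta> ^ 3) * q / (q - 3))"
proof -
  have "(\<integral>\<^sup>+v. ennreal (sqrt (1 + (\<beta> * norm (v::vec3))\<^sup>2) powr - q) \<partial>lborel)
     \<le> ennreal (4 * pi / (3 * \<beta> ^ 3) * q / (q - 3))"
  proof (rule nn_integral_bracket_powr_le)
    fix r :: real assume r: "r > 0"
    have "{v \<in> space lborel. \<beta> * norm (v::vec3) < r} = ball 0 (r / \<beta>)"
      using assms by (auto simp: field_simps)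
    then have "emeasure lborel {v \<in> space lborel. \<beta> * norm (v::vec3) < r} = ennreal (4 / 3 * pi * (r / \<beta>) ^ 3)"
      using r assms by (simp add: emeasure_ball eval_unit_ball_vol unit_ball_vol_numeral)
    also have "4 / 3 * pi * (r / \<beta>) ^ 3 = 4 * pi / (3 * \<beta> ^ 3) * r powr 3"
      using r assms by (simp add: powr_numeral power_divide)
    finally show "emeasure lborel {v \<in> space lborel. \<beta> * norm (v::vec3) < r} \<le> ennreal (4 * pi / (3 * \<beta> ^ 3) * r powr 3)"
      by simp
  qed (use assms in \<open>auto intro: lborel.sigma_finite_measure_axioms\<close>)
  then show ?thesis using assms by (simp add: jap_def)
qed

text \<open>
  The point of the line closest to the origin is at parameter \<open>- (x \<bullet> w) / |w|\<^sup>2\<close>, and the component along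
  \<open>w\<close> alone gives the lower bound.
\<close>

lemma norm_line_ge:
  fixes x w :: "'a::real_inner"
  assumes "w \<noteq> 0"
  shows "\<bar>s + (x \<bullet> w) / (norm w)\<^sup>2\<bar> * norm w \<le> norm (x + s *\<^sub>R w)"
proof -
  have "\<bar>s + (x \<bullet> w) / (norm w)\<^sup>2\<bar> * norm w * norm w = \<bar>(s + (x \<bullet> w) / (norm w)\<^sup>2) * (norm w)\<^sup>2\<bar>"
    by (simp add: abs_mult power2_eq_square)
  also have "(s + (x \<bullet> w) / (norm w)\<^sup>2) * (norm w)\<^sup>2 = (x + s *\<^sub>R w) \<bullet> w"
    using assms by (simp add: inner_add_left dot_square_norm distrib_right)
  also have "\<bar>(x + s *\<^sub>R w) \<bullet> w\<bar> \<le> norm (x + s *\<^sub>R w) * norm w" by (rule Cauchy_Schwarz_ineq2)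
  finally show ?thesis using assms by simp
qed

text \<open>
  A particle with relative velocity \<open>w\<close> spends a time of at most \<open>2 r / |w|\<close> in a ball of radius \<open>r\<close>,
  wherever it starts. The prefactor \<open>|w|\<close> is the one that the collision kernel supplies.
\<close>

lemma dispersive_integral_le:
  assumes "p > 1" "\<alpha> > 0"
  shows "(\<integral>\<^sup>+s. ennreal (norm w * jap (\<alpha> *\<^sub>R (x + s *\<^sub>R w)) powr - p) \<partial>lborel) \<le> ennreal (2 * p / (\<alpha> * (p - 1)))"
proof (cases "w = 0")
  case False
  define c where "c = 2 / (\<alpha> * norm w)"
  have "(\<integral>\<^sup>+s. ennreal (sqrt (1 + (\<alpha> * norm (x + s *\<^sub>R w))\<^sup>2) powr - p) \<partial>lborel) \<le> ennreal (c * p / (p - 1))"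
  proof (rule nn_integral_bracket_powr_le)
    fix r :: real assume r: "r > 0"
    let ?m = "- (x \<bullet> w) / (norm w)\<^sup>2" and ?h = "r / (\<alpha> * norm w)"
    have "s \<in> {?m - ?h..?m + ?h}" if "\<alpha> * norm (x + s *\<^sub>R w) < r" for s
    proof -
      have "\<bar>s + (x \<bullet> w) / (norm w)\<^sup>2\<bar> * norm w \<le> r / \<alpha>"
      proof -
        have "norm (x + s *\<^sub>R w) \<le> r / \<alpha>" using that assms by (simp add: field_simps)
        then show ?thesis using norm_line_ge[OF False, of s x] by linarith
      qed
      then have "\<bar>s + (x \<bullet> w) / (norm w)\<^sup>2\<bar> \<le> ?h"
        using False assms by (simp add: field_simps)
      then show ?thesis by auto
    qed
    then have "emeasure lborel {s \<in> space lborel. \<alpha> * norm (x + s *\<^sub>R w) < r} \<le> emeasure lborel {?m - ?h..?m + ?h}"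
      by (intro emeasure_mono) auto
    also have "\<dots> = ennreal (c * r powr 1)"
      using r assms False by (simp add: c_def field_simps)
    finally show "emeasure lborel {s \<in> space lborel. \<alpha> * norm (x + s *\<^sub>R w) < r} \<le> ennreal (c * r powr 1)" .
  qed (use assms in \<open>auto intro: lborel.sigma_finite_measure_axioms simp: c_def\<close>)
  then have *: "(\<integral>\<^sup>+s. ennreal (jap (\<alpha> *\<^sub>R (x + s *\<^sub>R w)) powr - p) \<partial>lborel) \<le> ennreal (c * p / (p - 1))"
    using assms by (simp add: jap_def)
  have "(\<integral>\<^sup>+s. ennreal (norm w * jap (\<alpha> *\<^sub>R (x + s *\<^sub>R w)) powr - p) \<partial>lborel)
    = ennreal (norm w) * (\<integral>\<^sup>+s. ennreal (jap (\<alpha> *\<^sub>R (x + s *\<^sub>R w)) powr - p) \<partial>lborel)"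
    by (subst nn_integral_cmult[symmetric]) (auto simp: ennreal_mult)
  also have "\<dots> \<le> ennreal (norm w) * ennreal (c * p / (p - 1))" by (intro mult_left_mono *) simp
  also have "\<dots> = ennreal (2 * p / (\<alpha> * (p - 1)))"
    using False assms by (simp add: c_def flip: ennreal_mult)
  finally show ?thesis .
qed simp

section \<open>Geometry of a collision\<close>

text \<open>
  Outgoing velocities of a collision of \<open>v\<close> and \<open>v1\<close>: for a unit vector \<open>\<sigma>\<close> they are antipodal points of the
  sphere that has the segment from \<open>v\<close> to \<open>v1\<close> as a diameter.
\<close>

definition out_plus :: "vec3 \<Rightarrow> vec3 \<Rightarrow> vec3 \<Rightarrow> vec3" where
  "out_plus v v1 \<sigma> = (1 / 2) *\<^sub>R (v + v1) + (norm (v - v1) / 2) *\<^sub>R \<sigma>"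

definition out_minus :: "vec3 \<Rightarrow> vec3 \<Rightarrow> vec3 \<Rightarrow> vec3" where
  "out_minus v v1 \<sigma> = (1 / 2) *\<^sub>R (v + v1) - (norm (v - v1) / 2) *\<^sub>R \<sigma>"

text \<open>
  The four velocities of a collision are the vertices of a rectangle with diagonals \<open>v v1\<close> and
  \<open>v2 v3\<close>. The map \<open>u \<mapsto> y + s (v - u)\<close> only scales and translates, so it preserves this up to degeneration, and the
  squared distances from the origin to opposite vertices of a rectangle have equal sums. With \<open>y = - v\<close> and
  \<open>s = 1\<close> this is conservation of energy.
\<close>

lemma scattering_rectangle:
  assumes "norm \<sigma> = 1"
  shows "(norm (y + s *\<^sub>R (v - out_plus v v1 \<sigma>)))\<^sup>2 + (norm (y + s *\<^sub>R (v - out_minus v v1 \<sigma>)))\<^sup>2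
    = (norm y)\<^sup>2 + (norm (y + s *\<^sub>R (v - v1)))\<^sup>2"
proof -
  define w where "w = v - v1"
  have v: "v = v1 + w" by (simp add: w_def)
  define u where "u = y + (s / 2) *\<^sub>R w"
  have pos: "y + s *\<^sub>R (v - out_plus v v1 \<sigma>) = u - (s * norm w / 2) *\<^sub>R \<sigma>"
    "y + s *\<^sub>R (v - out_minus v v1 \<sigma>) = u + (s * norm w / 2) *\<^sub>R \<sigma>"
    "y = u - (s / 2) *\<^sub>R w" "y + s *\<^sub>R (v - v1) = u + (s / 2) *\<^sub>R w"
    unfolding out_plus_def out_minus_def u_def v
    by (simp_all add: vec_eq_iff field_simps)
  have par: "(norm (u - z))\<^sup>2 + (norm (u + z))\<^sup>2 = 2 * (norm u)\<^sup>2 + 2 * (norm z)\<^sup>2" for z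
    unfolding power2_norm_eq_inner
    by (simp add: inner_add_left inner_add_right inner_diff_left inner_diff_right inner_commute)
  have sq: "(norm (u - (s / 2) *\<^sub>R w))\<^sup>2 + (norm (u + (s / 2) *\<^sub>R w))\<^sup>2
    = (norm (u - (s * norm w / 2) *\<^sub>R \<sigma>))\<^sup>2 + (norm (u + (s * norm w / 2) *\<^sub>R \<sigma>))\<^sup>2"
    unfolding par using assms by (simp add: power_mult_distrib power_divide)
  show ?thesis unfolding pos(1,2,4) using sq pos(3) by simp
qed

lemma scattering_energy:
  assumes "norm \<sigma> = 1"
  shows "(norm (out_plus v v1 \<sigma>))\<^sup>2 + (norm (out_minus v v1 \<sigma>))\<^sup>2 = (norm v)\<^sup>2 + (norm v1)\<^sup>2"
  using scattering_rectangle[OF assms, of "-v" 1 v v1]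
  by (simp add: norm_minus_commute)

lemma jap_le_mult:
  assumes "(norm z)\<^sup>2 \<le> (norm a)\<^sup>2 + (norm b)\<^sup>2"
  shows "jap z \<le> jap a * jap b"
proof -
  have "1 + (norm z)\<^sup>2 \<le> (1 + (norm a)\<^sup>2) * (1 + (norm b)\<^sup>2)"
    using assms by (simp add: distrib_left distrib_right add.assoc) (smt (verit) mult_nonneg_nonneg zero_le_power2)
  then show ?thesis unfolding jap_def by (simp flip: real_sqrt_mult)
qed

text \<open>
  This is how two of the three weights in a collision integral reproduce the weight at the original
  point: \<open>a\<close> and \<open>b\<close> are opposite vertices of a rectangle and \<open>z\<close> is one of the other two.
\<close>

lemma jap_powr_mult_le:
  assumes "(norm z)\<^sup>2 \<le> (norm a)\<^sup>2 + (norm b)\<^sup>2" "r > 0"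
  shows "jap (c *\<^sub>R a) powr - r * jap (c *\<^sub>R b) powr - r \<le> jap (c *\<^sub>R z) powr - r"
proof -
  have "c\<^sup>2 * (norm z)\<^sup>2 \<le> c\<^sup>2 * ((norm a)\<^sup>2 + (norm b)\<^sup>2)"
    using assms(1) by (rule mult_left_mono) simp
  then have "jap (c *\<^sub>R z) \<le> jap (c *\<^sub>R a) * jap (c *\<^sub>R b)"
    by (intro jap_le_mult) (simp add: power_mult_distrib distrib_left)
  then have "(jap (c *\<^sub>R a) * jap (c *\<^sub>R b)) powr - r \<le> jap (c *\<^sub>R z) powr - r"
    using assms(2) by (intro powr_mono2') auto
  then show ?thesis by (simp add: powr_mult less_imp_le)
qed

lemma jap_powr_neg_le_1: "r > 0 \<Longrightarrow> jap y powr - r \<le> 1"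
  using powr_mono2'[of "-r" 1 "jap y"] jap_ge_1[of y] by simp

text \<open>
  The four collision terms differ only in which three of the four velocities \<open>v, v1, v2, v3\<close> are handed to
  the particles \<open>j\<close>, \<open>k + 1\<close> and \<open>k + 2\<close>: \<open>(v1, v2, v3)\<close>, \<open>(v, v2, v3)\<close>, \<open>(v, v1, v3)\<close> and \<open>(v, v1, v2)\<close> for
  \<open>l = 0, 1, 2, 3\<close>.
\<close>

definition slot1 :: "nat \<Rightarrow> vec3 \<Rightarrow> vec3 \<Rightarrow> vec3" where
  "slot1 l v v1 = (if l = 0 then v1 else v)"

definition slot2 :: "nat \<Rightarrow> vec3 \<Rightarrow> vec3 \<Rightarrow> vec3 \<Rightarrow> vec3" where
  "slot2 l v v1 \<sigma> = (if l \<le> 1 then out_plus v v1 \<sigma> else v1)"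

definition slot3 :: "nat \<Rightarrow> vec3 \<Rightarrow> vec3 \<Rightarrow> vec3 \<Rightarrow> vec3" where
  "slot3 l v v1 \<sigma> = (if l = 3 then out_plus v v1 \<sigma> else out_minus v v1 \<sigma>)"

lemma borel_measurable_out [measurable (raw)]:
  assumes [measurable]: "f \<in> borel_measurable M" "g \<in> borel_measurable M" "h \<in> borel_measurable M"
  shows "(\<lambda>x. out_plus (f x) (g x) (h x)) \<in> borel_measurable M"
    "(\<lambda>x. out_minus (f x) (g x) (h x)) \<in> borel_measurable M"
  unfolding out_plus_def out_minus_def by measurable

lemma borel_measurable_slot [measurable (raw)]:
  assumes [measurable]: "f \<in> borel_measurable M" "g \<in> borel_measurable M" "h \<in> borel_measurable M"
  shows "(\<lambda>x. slot1 l (f x) (g x)) \<in> borel_measurable M"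
    "(\<lambda>x. slot2 l (f x) (g x) (h x)) \<in> borel_measurable M"
    "(\<lambda>x. slot3 l (f x) (g x) (h x)) \<in> borel_measurable M"
  unfolding slot1_def slot2_def slot3_def by (cases "l = 0"; cases "l \<le> 1"; cases "l = 3"; simp)+

section \<open>The Leibniz rule for products of integrals\<close>

text \<open>
  The square \<open>[0,t] \<times> [0,t]\<close> is split along its diagonal, a null set; on each of
  the two triangles Tonelli integrates one factor up to the time of the other.
\<close>

lemma mult_of_integrals:
  fixes a b :: "real \<Rightarrow> ennreal" and c d :: ennreal
  assumes [measurable]: "a \<in> borel_measurable borel" "b \<in> borel_measurable borel"
  defines "A \<equiv> \<lambda>t. c + (\<integral>\<^sup>+s. a s * indicator {0..t} s \<partial>lborel)"
    and "B \<equiv> \<lambda>t. d + (\<integral>\<^sup>+s. b s * indicator {0..t} s \<partial>lborel)"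
  shows "A t * B t = c * d + (\<integral>\<^sup>+s. (a s * B s + A s * b s) * indicator {0..t} s \<partial>lborel)"
proof -
  define a' b' where "a' s = a s * indicator {0..t} s" and "b' s = b s * indicator {0..t} s" for s
  have [measurable]: "a' \<in> borel_measurable borel" "b' \<in> borel_measurable borel"
    unfolding a'_def[abs_def] b'_def[abs_def] by measurable
  let ?I = "\<integral>\<^sup>+s. a' s \<partial>lborel" and ?J = "\<integral>\<^sup>+s. b' s \<partial>lborel"
  have m: "(\<lambda>(s, r). a' s * b' r * indicator {r. r \<le> s} r) \<in> borel_measurable (lborel \<Otimes>\<^sub>M lborel)"
    "(\<lambda>(s, r). a' s * b' r * indicator {s. s \<le> r} s) \<in> borel_measurable (lborel \<Otimes>\<^sub>M lborel)"
    unfolding indicator_def atLeastAtMost_iff by measurable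
  have "(\<integral>\<^sup>+s. a' s * (\<integral>\<^sup>+r. b r * indicator {0..s} r \<partial>lborel) \<partial>lborel)
     = (\<integral>\<^sup>+s. \<integral>\<^sup>+r. a' s * b' r * indicator {r. r \<le> s} r \<partial>lborel \<partial>lborel)"
    by (simp add: nn_integral_cmult[symmetric]) 
      (intro nn_integral_cong, auto simp: a'_def b'_def indicator_def mult_ac)
  moreover have "(\<integral>\<^sup>+r. (\<integral>\<^sup>+s. a s * indicator {0..r} s \<partial>lborel) * b' r \<partial>lborel)
     = (\<integral>\<^sup>+s. \<integral>\<^sup>+r. a' s * b' r * indicator {s. s \<le> r} s \<partial>lborel \<partial>lborel)"
  proof -
    have "(\<integral>\<^sup>+r. (\<integral>\<^sup>+s. a s * indicator {0..r} s \<partial>lborel) * b' r \<partial>lborel)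
      = (\<integral>\<^sup>+r. \<integral>\<^sup>+s. a' s * b' r * indicator {s. s \<le> r} s \<partial>lborel \<partial>lborel)"
      by (simp add: nn_integral_multc[symmetric])
        (auto simp: a'_def b'_def indicator_def mult_ac intro!: nn_integral_cong)
    also have "\<dots> = (\<integral>\<^sup>+s. \<integral>\<^sup>+r. a' s * b' r * indicator {s. s \<le> r} s \<partial>lborel \<partial>lborel)"
      by (rule lborel_pair.Fubini') (rule m)
    finally show ?thesis .
  qed
  moreover have "(\<integral>\<^sup>+s. \<integral>\<^sup>+r. a' s * b' r * indicator {r. r \<le> s} r \<partial>lborel \<partial>lborel)
     + (\<integral>\<^sup>+s. \<integral>\<^sup>+r. a' s * b' r * indicator {s. s \<le> r} s \<partial>lborel \<partial>lborel) = ?I * ?J"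
  proof -
    have "(\<integral>\<^sup>+s. \<integral>\<^sup>+r. a' s * b' r * indicator {r. r \<le> s} r \<partial>lborel \<partial>lborel)
     + (\<integral>\<^sup>+s. \<integral>\<^sup>+r. a' s * b' r * indicator {s. s \<le> r} s \<partial>lborel \<partial>lborel)
      = (\<integral>\<^sup>+s. \<integral>\<^sup>+r. a' s * b' r * indicator {r. r \<le> s} r + a' s * b' r * indicator {s. s \<le> r} s \<partial>lborel \<partial>lborel)"
      using m by (subst nn_integral_add[symmetric]) (auto simp: nn_integral_add)
    also have "\<dots> = (\<integral>\<^sup>+s. \<integral>\<^sup>+r. a' s * b' r \<partial>lborel \<partial>lborel)"
    proof (rule nn_integral_cong, rule nn_integral_cong_AE)
      fix s :: real
      have "AE r in lborel. r \<noteq> s" by (rule AE_lborel_singleton)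
      then show "AE r in lborel. a' s * b' r * indicator {r. r \<le> s} r + a' s * b' r * indicator {s. s \<le> r} s = a' s * b' r"
        by eventually_elim (auto simp: indicator_def)
    qed
    also have "\<dots> = ?I * ?J" by (simp add: nn_integral_cmult nn_integral_multc)
    finally show ?thesis .
  qed
  ultimately have IJ: "(\<integral>\<^sup>+s. a' s * (\<integral>\<^sup>+r. b r * indicator {0..s} r \<partial>lborel) \<partial>lborel)
    + (\<integral>\<^sup>+r. (\<integral>\<^sup>+s. a s * indicator {0..r} s \<partial>lborel) * b' r \<partial>lborel) = ?I * ?J" by simp
  have mA[measurable]: "(\<lambda>t. \<integral>\<^sup>+s. a s * indicator {0..t} s \<partial>lborel) \<in> borel_measurable borel"
    "(\<lambda>t. \<integral>\<^sup>+s. b s * indicator {0..t} s \<partial>lborel) \<in> borel_measurable borel"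
    unfolding indicator_def atLeastAtMost_iff by measurable
  have "(\<integral>\<^sup>+s. (a s * B s + A s * b s) * indicator {0..t} s \<partial>lborel)
    = (\<integral>\<^sup>+s. a' s * d + a' s * (\<integral>\<^sup>+r. b r * indicator {0..s} r \<partial>lborel) + (c * b' s + (\<integral>\<^sup>+r. a r * indicator {0..s} r \<partial>lborel) * b' s) \<partial>lborel)"
    by (intro nn_integral_cong) (simp add: A_def B_def a'_def b'_def algebra_simps)
  also have "\<dots> = ?I * d + c * ?J + ?I * ?J"
    by (simp add: nn_integral_add nn_integral_cmult nn_integral_multc flip: IJ)
  finally have *: "(\<integral>\<^sup>+s. (a s * B s + A s * b s) * indicator {0..t} s \<partial>lborel) = ?I * d + c * ?J + ?I * ?J" .
  have "A t * B t = (c + ?I) * (d + ?J)" by (simp only: A_def B_def a'_def b'_def)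
  also have "\<dots> = c * d + (?I * d + c * ?J + ?I * ?J)" by (simp only: distrib_left distrib_right add_ac)
  finally show ?thesis unfolding * .
qed

lemma prod_of_integrals:
  fixes a :: "'i \<Rightarrow> real \<Rightarrow> ennreal" and c :: "'i \<Rightarrow> ennreal"
  assumes "finite I" and a: "\<And>i. a i \<in> borel_measurable borel"
  defines "U \<equiv> \<lambda>i t. c i + (\<integral>\<^sup>+s. a i s * indicator {0..t} s \<partial>lborel)"
  shows "(\<Prod>i\<in>I. U i t) = (\<Prod>i\<in>I. c i)
    + (\<integral>\<^sup>+s. (\<Sum>j\<in>I. a j s * (\<Prod>i\<in>I - {j}. U i s)) * indicator {0..t} s \<partial>lborel)"
  using \<open>finite I\<close>
proof (induction arbitrary: t)
  case (insert m I)
  note a[measurable]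
  have [measurable]: "U i \<in> borel_measurable borel" for i
    unfolding U_def indicator_def atLeastAtMost_iff by measurable
  define w where "w s = (\<Sum>j\<in>I. a j s * (\<Prod>i\<in>I - {j}. U i s))" for s
  have [measurable]: "w \<in> borel_measurable borel" unfolding w_def by measurable
  have IH: "(\<Prod>i\<in>I. U i t) = (\<Prod>i\<in>I. c i) + (\<integral>\<^sup>+s. w s * indicator {0..t} s \<partial>lborel)" for t
    unfolding w_def by (rule insert.IH)
  have "(\<Sum>j\<in>insert m I. a j s * (\<Prod>i\<in>insert m I - {j}. U i s)) = a m s * (\<Prod>i\<in>I. U i s) + U m s * w s" for s
  proof -
    have "(\<Prod>i\<in>insert m I - {j}. U i s) = U m s * (\<Prod>i\<in>I - {j}. U i s)" if "j \<in> I" for j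
      using that insert.hyps by (subst insert_Diff_if) auto
    then show ?thesis using insert.hyps
      by (simp add: w_def sum_distrib_left mult_ac)
  qed
  note step = this
  have "U m t * (\<Prod>i\<in>I. U i t) = c m * (\<Prod>i\<in>I. c i)
    + (\<integral>\<^sup>+s. (a m s * (\<Prod>i\<in>I. U i s) + U m s * w s) * indicator {0..t} s \<partial>lborel)"
    unfolding IH by (simp only: U_def) (rule mult_of_integrals, measurable)
  then show ?case using insert.hyps by (simp add: step)
qed simp

section \<open>Adding two particles in the moving frame\<close>

text \<open>
  The state of \<open>k + 2\<close> particles that a collision of particle \<open>j\<close> at time \<open>s\<close> refers to, pulled back to time
  \<open>0\<close> along free transport. At time \<open>s\<close> the particles \<open>j\<close>, \<open>k + 1\<close> and \<open>k + 2\<close> all sit at \<open>x\<^sub>j + s v\<^sub>j\<close>; their new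
  velocities carry them back to points of their own, while all other particles return to where
  they came from.
\<close>

definition fan_pos :: "nat \<Rightarrow> nat \<Rightarrow> nat \<Rightarrow> config \<Rightarrow> config \<Rightarrow> real \<Rightarrow> vec3 \<Rightarrow> vec3 \<Rightarrow> config" where
  "fan_pos l j k X V s v1 \<sigma> =
     X(j := X j + s *\<^sub>R (V j - slot1 l (V j) v1),
       k + 1 := X j + s *\<^sub>R (V j - slot2 l (V j) v1 \<sigma>),
       k + 2 := X j + s *\<^sub>R (V j - slot3 l (V j) v1 \<sigma>))"

definition fan_vel :: "nat \<Rightarrow> nat \<Rightarrow> nat \<Rightarrow> config \<Rightarrow> vec3 \<Rightarrow> vec3 \<Rightarrow> config" where
  "fan_vel l j k V v1 \<sigma> =
     V(j := slot1 l (V j) v1, k + 1 := slot2 l (V j) v1 \<sigma>, k + 2 := slot3 l (V j) v1 \<sigma>)"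

lemma space_conf: "space (conf k) = extensional {1..k}"
  by (auto simp: conf_def space_PiM PiE_def)

lemma fan_in_space:
  assumes "j \<in> {1..k}"
  shows "X \<in> space (conf k) \<Longrightarrow> fan_pos l j k X V s v1 \<sigma> \<in> space (conf (k + 2))"
    and "V \<in> space (conf k) \<Longrightarrow> fan_vel l j k V v1 \<sigma> \<in> space (conf (k + 2))"
  using assms by (auto simp: space_conf extensional_def fan_pos_def fan_vel_def)

text \<open>
  A tensor power evaluated on a fan splits into the spectators, which do not see the collision, and a
  triple product at particle \<open>j\<close>.
\<close>

lemma prod_fan:
  fixes f :: "vec3 \<Rightarrow> vec3 \<Rightarrow> 'a::comm_monoid_mult"
  assumes "j \<in> {1..k}"
  shows "(\<Prod>i=1..k+2. f (fan_pos l j k X V s v1 \<sigma> i) (fan_vel l j k V v1 \<sigma> i)) =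
     (\<Prod>i\<in>{1..k} - {j}. f (X i) (V i)) *
     (f (X j + s *\<^sub>R (V j - slot1 l (V j) v1)) (slot1 l (V j) v1) *
      f (X j + s *\<^sub>R (V j - slot2 l (V j) v1 \<sigma>)) (slot2 l (V j) v1 \<sigma>) *
      f (X j + s *\<^sub>R (V j - slot3 l (V j) v1 \<sigma>)) (slot3 l (V j) v1 \<sigma>))"
proof -
  let ?g = "\<lambda>i. f (fan_pos l j k X V s v1 \<sigma> i) (fan_vel l j k V v1 \<sigma> i)"
  have "(\<Prod>i\<in>{1..k+2}. ?g i) = (\<Prod>i\<in>insert (k+2) (insert (k+1) (insert j ({1..k} - {j}))). ?g i)"
    using assms by (intro prod.cong) auto
  also have "\<dots> = ?g (k+2) * (?g (k+1) * (?g j * (\<Prod>i\<in>{1..k} - {j}. ?g i)))"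
    using assms by (simp del: insert_Diff_single)
  also have "(\<Prod>i\<in>{1..k} - {j}. ?g i) = (\<Prod>i\<in>{1..k} - {j}. f (X i) (V i))"
    by (intro prod.cong) (auto simp: fan_pos_def fan_vel_def)
  finally show ?thesis using assms by (simp add: fan_pos_def fan_vel_def mult_ac)
qed

text \<open>
  The integrand of the \<open>l\<close>-th collision term for particle \<open>j\<close>, read in the moving frame: the configuration
  \<open>X\<close> is first transported forward to time \<open>s\<close>.
\<close>

definition branch :: "nat \<Rightarrow> nat \<Rightarrow> nat \<Rightarrow> (real \<Rightarrow> hierarchy) \<Rightarrow> config \<Rightarrow> config \<Rightarrow> real \<Rightarrow> vec3 \<Rightarrow> vec3 \<Rightarrow> real" where
  "branch l j k F X V s v1 \<sigma> = norm (V j - v1) / 8 *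
     F s (k + 2) (ext_pos j k (\<lambda>i\<in>{1..k}. X i + s *\<^sub>R V i)) (fan_vel l j k V v1 \<sigma>)"

definition channel_sign :: "nat \<Rightarrow> real" where "channel_sign l = (if l \<le> 1 then 1 else - 1)"

lemma transport_collision_eq:
  "transport k (- s) (collision k (F s (k + 2))) X V =
    (\<Sum>j=1..k. \<Sum>l<4. channel_sign l *
       (\<integral>(v1, \<sigma>). branch l j k F X V s v1 \<sigma> \<partial>(lborel \<Otimes>\<^sub>M sphere_measure)))"
proof -
  let ?Y = "\<lambda>i\<in>{1..k}. X i + s *\<^sub>R V i"
  have *: "delta_integral (V j) (\<lambda>v1 v2 v3. F s (k + 2) (ext_pos j k ?Y) (g v1 v2 v3)) =
     (\<integral>(v1, \<sigma>). branch l j k F X V s v1 \<sigma> \<partial>(lborel \<Otimes>\<^sub>M sphere_measure))"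
    if "\<And>v1 \<sigma>. g v1 (out_plus (V j) v1 \<sigma>) (out_minus (V j) v1 \<sigma>) = fan_vel l j k V v1 \<sigma>" for g l j
    unfolding delta_integral_def branch_def that[unfolded out_plus_def out_minus_def]
    by (subst integral_mult_right_zero[symmetric]) (simp add: case_prod_unfold)
  have "coll_L0 j k (F s (k + 2)) ?Y V = (\<integral>(v1, \<sigma>). branch 0 j k F X V s v1 \<sigma> \<partial>(lborel \<Otimes>\<^sub>M sphere_measure))"
       "coll_L1 j k (F s (k + 2)) ?Y V = (\<integral>(v1, \<sigma>). branch 1 j k F X V s v1 \<sigma> \<partial>(lborel \<Otimes>\<^sub>M sphere_measure))"
       "coll_L2 j k (F s (k + 2)) ?Y V = (\<integral>(v1, \<sigma>). branch 2 j k F X V s v1 \<sigma> \<partial>(lborel \<Otimes>\<^sub>M sphere_measure))"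
       "coll_L3 j k (F s (k + 2)) ?Y V = (\<integral>(v1, \<sigma>). branch 3 j k F X V s v1 \<sigma> \<partial>(lborel \<Otimes>\<^sub>M sphere_measure))" for j
    unfolding coll_L0_def coll_L1_def coll_L2_def coll_L3_def
    by (rule *; simp add: fan_vel_def slot1_def slot2_def slot3_def)+
  then show ?thesis
    by (simp add: transport_def collision_def channel_sign_def numeral_eq_Suc)
qed

lemma branch_moving_frame:
  assumes j: "j \<in> {1..k}"
  shows "branch l j k F X V s v1 \<sigma> = norm (V j - v1) / 8 *
     transport (k + 2) (- s) (F s (k + 2)) (fan_pos l j k X V s v1 \<sigma>) (fan_vel l j k V v1 \<sigma>)"
proof -
  have "(\<lambda>i\<in>{1..k+2}. fan_pos l j k X V s v1 \<sigma> i - (- s) *\<^sub>R fan_vel l j k V v1 \<sigma> i)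
     = ext_pos j k (\<lambda>i\<in>{1..k}. X i + s *\<^sub>R V i)"
    using j by (auto simp: fun_eq_iff fan_pos_def fan_vel_def ext_pos_def restrict_def algebra_simps)
  then show ?thesis by (simp add: branch_def transport_def)
qed

text \<open>
  The solution is only known to be measurable in time on \<open>[0,T]\<close>, so time is clamped to this interval
  before it is composed with the measurable fan; on \<open>[0,t]\<close> clamping changes nothing.
\<close>

lemma borel_measurable_branch:
  assumes F: "(\<lambda>(t, X, V). F t (k + 2) X V) \<in>
        borel_measurable (restrict_space borel {0..T} \<Otimes>\<^sub>M (conf (k + 2) \<Otimes>\<^sub>M conf (k + 2)))"
    and t: "t \<in> {0..T}" and j: "j \<in> {1..k}" and V: "V \<in> space (conf k)"
  shows "(\<lambda>(s, v1, \<sigma>). indicator {0..t} s * branch l j k F X V s v1 \<sigma>)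
     \<in> borel_measurable (lborel \<Otimes>\<^sub>M (lborel \<Otimes>\<^sub>M sphere_measure))"
proof -
  let ?N = "lborel \<Otimes>\<^sub>M (lborel \<Otimes>\<^sub>M sphere_measure) :: (real \<times> vec3 \<times> vec3) measure"
  let ?Y = "\<lambda>s. ext_pos j k (\<lambda>i\<in>{1..k}. X i + s *\<^sub>R V i)"
  let ?c = "\<lambda>s. max 0 (min T s)"
  have clamp: "max 0 (min T s) = s" if "0 \<le> s" "s \<le> t" for s
    using that t by auto
  have mY: "(\<lambda>w. ?Y (fst w)) \<in> ?N \<rightarrow>\<^sub>M conf (k + 2)"
    unfolding conf_def
  proof (rule measurable_PiM_single')
    fix i assume i: "i \<in> {1..k+2}"
    show "(\<lambda>w. ?Y (fst w) i) \<in> ?N \<rightarrow>\<^sub>M borel"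
      unfolding ext_pos_def using i j by (cases "i = k + 2"; cases "i = k + 1") auto
  qed (use j in \<open>auto simp: ext_pos_def PiE_def extensional_def\<close>)
  have mW: "(\<lambda>w. fan_vel l j k V (fst (snd w)) (snd (snd w))) \<in> ?N \<rightarrow>\<^sub>M conf (k + 2)"
    unfolding conf_def
  proof (rule measurable_PiM_single')
    fix i assume i: "i \<in> {1..k+2}"
    show "(\<lambda>w. fan_vel l j k V (fst (snd w)) (snd (snd w)) i) \<in> ?N \<rightarrow>\<^sub>M borel"
      unfolding fan_vel_def using i j by (cases "i = k + 2"; cases "i = k + 1"; cases "i = j") auto
  qed (use j V in \<open>auto simp: fan_vel_def PiE_def extensional_def space_conf\<close>)
  have mc: "(\<lambda>w. ?c (fst w)) \<in> ?N \<rightarrow>\<^sub>M restrict_space borel {0..T}"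
    using t by (intro measurable_restrict_space2) auto
  have [measurable]: "(\<lambda>w. F (?c (fst w)) (k + 2) (?Y (fst w)) (fan_vel l j k V (fst (snd w)) (snd (snd w)))) \<in> borel_measurable ?N"
  proof -
    have "(\<lambda>w. (?c (fst w), ?Y (fst w), fan_vel l j k V (fst (snd w)) (snd (snd w)))) \<in>
        ?N \<rightarrow>\<^sub>M restrict_space borel {0..T} \<Otimes>\<^sub>M (conf (k + 2) \<Otimes>\<^sub>M conf (k + 2))"
      by (intro measurable_Pair mc mY mW)
    from measurable_compose[OF this F] show ?thesis by simp
  qed
  have "(\<lambda>w. indicator {0..t} (fst w) * (norm (V j - fst (snd w)) / 8 *
      F (?c (fst w)) (k + 2) (?Y (fst w)) (fan_vel l j k V (fst (snd w)) (snd (snd w))))) \<in> borel_measurable ?N"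
    by measurable
  also have "(\<lambda>w. indicator {0..t} (fst w) * (norm (V j - fst (snd w)) / 8 *
      F (?c (fst w)) (k + 2) (?Y (fst w)) (fan_vel l j k V (fst (snd w)) (snd (snd w)))))
    = (\<lambda>(s, v1, \<sigma>). indicator {0..t} s * branch l j k F X V s v1 \<sigma>)"
    using clamp by (auto simp: fun_eq_iff branch_def indicator_def simp del: max.absorb1 max.absorb2)
  finally show ?thesis .
qed

lemma sigma_finite_sphere: "sigma_finite_measure sphere_measure"
  by (rule finite_measure.axioms(1)) (rule finite_measureI, simp add: emeasure_sphere_measure_UNIV)

lemma nn_integral_triple:
  fixes f :: "real \<Rightarrow> vec3 \<Rightarrow> vec3 \<Rightarrow> ennreal"
  assumes f: "(\<lambda>(s, v1, \<sigma>). f s v1 \<sigma>) \<in> borel_measurable (lborel \<Otimes>\<^sub>M (lborel \<Otimes>\<^sub>M sphere_measure))"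
  shows "(\<integral>\<^sup>+(s, v1, \<sigma>). f s v1 \<sigma> \<partial>(lborel \<Otimes>\<^sub>M (lborel \<Otimes>\<^sub>M sphere_measure)))
     = (\<integral>\<^sup>+s. \<integral>\<^sup>+v1. \<integral>\<^sup>+\<sigma>. f s v1 \<sigma> \<partial>sphere_measure \<partial>lborel \<partial>lborel)"
proof -
  interpret S: sigma_finite_measure sphere_measure by (rule sigma_finite_sphere)
  interpret LS: pair_sigma_finite "lborel :: vec3 measure" sphere_measure ..
  note f[measurable]
  have "(\<integral>\<^sup>+(s, v1, \<sigma>). f s v1 \<sigma> \<partial>(lborel \<Otimes>\<^sub>M (lborel \<Otimes>\<^sub>M sphere_measure)))
    = (\<integral>\<^sup>+s. \<integral>\<^sup>+w. f s (fst w) (snd w) \<partial>(lborel \<Otimes>\<^sub>M sphere_measure) \<partial>lborel)"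
    using LS.P.nn_integral_fst[OF f] by (simp add: case_prod_unfold)
  also have "(\<lambda>s. \<integral>\<^sup>+w. f s (fst w) (snd w) \<partial>(lborel \<Otimes>\<^sub>M sphere_measure)) =
    (\<lambda>s. \<integral>\<^sup>+v1. \<integral>\<^sup>+\<sigma>. f s v1 \<sigma> \<partial>sphere_measure \<partial>lborel)"
  proof
    fix s
    have "(\<lambda>w. f s (fst w) (snd w)) \<in> borel_measurable (lborel \<Otimes>\<^sub>M sphere_measure)"
      using measurable_compose[OF measurable_Pair1' f, of s] by (simp add: case_prod_unfold)
    from S.nn_integral_fst[OF this]
    show "(\<integral>\<^sup>+w. f s (fst w) (snd w) \<partial>(lborel \<Otimes>\<^sub>M sphere_measure)) =
      (\<integral>\<^sup>+v1. \<integral>\<^sup>+\<sigma>. f s v1 \<sigma> \<partial>sphere_measure \<partial>lborel)" by simp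
  qed
  finally show ?thesis .
qed

section \<open>The collision rate of the weight\<close>

locale weights =
  fixes p q \<alpha> \<beta> :: real
  assumes p: "p > 1" and q: "q > 3" and \<alpha>: "\<alpha> > 0" and \<beta>: "\<beta> > 0"

context weights
begin

definition weight :: "vec3 \<Rightarrow> vec3 \<Rightarrow> real" where
  "weight x v = jap (\<alpha> *\<^sub>R x) powr - p * jap (\<beta> *\<^sub>R v) powr - q"

lemma weight_pos: "weight x v > 0"
  using jap_pos by (auto simp: weight_def less_le)

lemma borel_measurable_weight [measurable (raw)]:
  assumes [measurable]: "f \<in> borel_measurable M" "g \<in> borel_measurable M"
  shows "(\<lambda>x. weight (f x) (g x)) \<in> borel_measurable M"
  unfolding weight_def by measurable

text \<open>
  \<open>channel l x v s\<close> is what \<open>branch l j k\<close> becomes when the hierarchy is frozen, in the moving frame, at tensor powers of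
  the weight, after division by the weights of the spectators.
\<close>

definition channel :: "nat \<Rightarrow> vec3 \<Rightarrow> vec3 \<Rightarrow> real \<Rightarrow> vec3 \<Rightarrow> vec3 \<Rightarrow> real" where
  "channel l x v s v1 \<sigma> = norm (v - v1) / 8 *
     (weight (x + s *\<^sub>R (v - slot1 l v v1)) (slot1 l v v1) *
      weight (x + s *\<^sub>R (v - slot2 l v v1 \<sigma>)) (slot2 l v v1 \<sigma>) *
      weight (x + s *\<^sub>R (v - slot3 l v v1 \<sigma>)) (slot3 l v v1 \<sigma>))"

lemma channel_nonneg: "channel l x v s v1 \<sigma> \<ge> 0"
  using weight_pos by (simp add: channel_def less_imp_le)

lemma borel_measurable_channel [measurable (raw)]:
  assumes [measurable]: "f \<in> borel_measurable M" "g \<in> borel_measurable M" "h \<in> borel_measurable M"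
  shows "(\<lambda>y. channel l x v (f y) (g y) (h y)) \<in> borel_measurable M"
  unfolding channel_def by measurable

abbreviation ray :: "vec3 \<Rightarrow> real \<Rightarrow> vec3 \<Rightarrow> real" where
  "ray x s w \<equiv> norm w * jap (\<alpha> *\<^sub>R (x + s *\<^sub>R w)) powr - p"

text \<open>
  For \<open>l = 0\<close> the rectangle identity, used for positions and for velocities, bounds the two outgoing weights by
  \<open>weight x v\<close>; for the other terms \<open>weight x v\<close> is itself one of the three factors. What is left is bounded by a
  velocity weight at \<open>v1\<close> and a position weight that decays along a ray. For \<open>l = 1\<close> this decay is
  along \<open>v - v2\<close> and \<open>v - v3\<close> instead of \<open>v - v1\<close>; since \<open>v - v1 = (v - v2) + (v - v3)\<close>, the kernel splits into
  the two matching factors.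
\<close>

lemma channel_le:
  assumes \<sigma>: "norm \<sigma> = 1"
  shows "channel l x v s v1 \<sigma> \<le> weight x v / 8 * jap (\<beta> *\<^sub>R v1) powr - q *
     (if l = 1 then ray x s (v - out_plus v v1 \<sigma>) + ray x s (v - out_minus v v1 \<sigma>) else ray x s (v - v1))"
proof -
  let ?v2 = "out_plus v v1 \<sigma>" and ?v3 = "out_minus v v1 \<sigma>"
  define P where "P w = jap (\<alpha> *\<^sub>R (x + s *\<^sub>R w)) powr - p" for w
  define Q where "Q w = jap (\<beta> *\<^sub>R w) powr - q" for w
  have PQ: "weight (x + s *\<^sub>R w) w' = P w * Q w'" "weight x v = P 0 * Q v" for w w'
    by (simp_all add: weight_def P_def Q_def)
  have P0: "P w \<ge> 0" "P w \<le> 1" "Q w \<ge> 0" "Q w \<le> 1" for w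
    using p q by (auto simp: P_def Q_def jap_powr_neg_le_1)
  have e: "(norm ?v2)\<^sup>2 + (norm ?v3)\<^sup>2 = (norm v)\<^sup>2 + (norm v1)\<^sup>2"
    by (rule scattering_energy[OF \<sigma>])
  have Q23: "Q ?v2 * Q ?v3 \<le> Q v" "Q ?v2 * Q ?v3 \<le> Q v1"
    using q by (auto simp: Q_def e intro!: jap_powr_mult_le)
  have P23: "P (v - ?v2) * P (v - ?v3) \<le> P 0"
    unfolding P_def using p
    by (intro jap_powr_mult_le) (auto simp: scattering_rectangle[OF \<sigma>])
  consider "l = 0" | "l = 1" | "l = 2" | "l = 3" | "l > 3" by linarith
  then show ?thesis
  proof cases
    case 1
    have "P (v - ?v2) * P (v - ?v3) * (Q ?v2 * Q ?v3) \<le> P 0 * Q v"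
      by (intro mult_mono P23 Q23 mult_nonneg_nonneg P0)
    then have "norm (v - v1) * P (v - v1) * Q v1 * (P (v - ?v2) * P (v - ?v3) * (Q ?v2 * Q ?v3))
       \<le> norm (v - v1) * P (v - v1) * Q v1 * (P 0 * Q v)"
      by (intro mult_left_mono) (simp_all add: P0)
    then show ?thesis
      using 1 by (simp add: channel_def PQ slot1_def slot2_def slot3_def P_def[symmetric] Q_def[symmetric] mult_ac)
  next
    case 2
    have w: "v - v1 = (v - ?v2) + (v - ?v3)"
      by (simp add: out_plus_def out_minus_def vec_eq_iff field_simps)
    have "norm (v - v1) \<le> norm (v - ?v2) + norm (v - ?v3)"
      unfolding w by (rule norm_triangle_ineq)
    then have "norm (v - v1) * (P (v - ?v2) * P (v - ?v3))
        \<le> (norm (v - ?v2) + norm (v - ?v3)) * (P (v - ?v2) * P (v - ?v3))"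
      by (intro mult_right_mono) (simp_all add: P0)
    also have "\<dots> \<le> norm (v - ?v2) * P (v - ?v2) + norm (v - ?v3) * P (v - ?v3)"
      unfolding distrib_right
      by (intro add_mono mult_left_mono mult_left_le mult_left_le_one_le) (auto simp: P0)
    finally have "(norm (v - v1) * (P (v - ?v2) * P (v - ?v3))) * (Q ?v2 * Q ?v3) \<le> (norm (v - ?v2) * P (v - ?v2) + norm (v - ?v3) * P (v - ?v3)) * Q v1"
      by (intro mult_mono Q23) (auto simp: P0)
    then have "P 0 * Q v * ((norm (v - v1) * (P (v - ?v2) * P (v - ?v3))) * (Q ?v2 * Q ?v3))
       \<le> P 0 * Q v * ((norm (v - ?v2) * P (v - ?v2) + norm (v - ?v3) * P (v - ?v3)) * Q v1)"
      by (intro mult_left_mono) (simp_all add: P0)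
    then show ?thesis
      using 2 by (simp add: channel_def PQ slot1_def slot2_def slot3_def P_def[symmetric] Q_def[symmetric] mult_ac)
  next
    case 3
    have "P (v - ?v3) * Q ?v3 \<le> 1" by (intro mult_le_one P0)
    then have "P 0 * Q v * (norm (v - v1) * P (v - v1) * Q v1) * (P (v - ?v3) * Q ?v3)
        \<le> P 0 * Q v * (norm (v - v1) * P (v - v1) * Q v1)"
      by (intro mult_right_le_one_le mult_left_le) (simp_all add: P0)
    then show ?thesis
      using 3 by (simp add: channel_def PQ slot1_def slot2_def slot3_def P_def[symmetric] Q_def[symmetric] mult_ac)
  next
    case 4
    have "P (v - ?v2) * Q ?v2 \<le> 1" by (intro mult_le_one P0)
    then have "P 0 * Q v * (norm (v - v1) * P (v - v1) * Q v1) * (P (v - ?v2) * Q ?v2)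
        \<le> P 0 * Q v * (norm (v - v1) * P (v - v1) * Q v1)"
      by (intro mult_left_le) (simp_all add: P0)
    then show ?thesis
      using 4 by (simp add: channel_def PQ slot1_def slot2_def slot3_def P_def[symmetric] Q_def[symmetric] mult_ac)
  next
    case 5
    have "P (v - ?v3) * Q ?v3 \<le> 1" by (intro mult_le_one P0)
    then have "P 0 * Q v * (norm (v - v1) * P (v - v1) * Q v1) * (P (v - ?v3) * Q ?v3)
        \<le> P 0 * Q v * (norm (v - v1) * P (v - v1) * Q v1)"
      by (intro mult_left_le) (simp_all add: P0)
    then show ?thesis
      using 5 by (simp add: channel_def PQ slot1_def slot2_def slot3_def P_def[symmetric] Q_def[symmetric] mult_ac)
  qed
qed

definition rate :: "vec3 \<Rightarrow> vec3 \<Rightarrow> real \<Rightarrow> ennreal" where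
  "rate x v s = (\<Sum>l<4::nat. \<integral>\<^sup>+v1. \<integral>\<^sup>+\<sigma>. ennreal (channel l x v s v1 \<sigma>) \<partial>sphere_measure \<partial>lborel)"

lemma borel_measurable_rate [measurable]: "rate x v \<in> borel_measurable borel"
proof -
  interpret S: sigma_finite_measure sphere_measure by (rule sigma_finite_sphere)
  show ?thesis unfolding rate_def[abs_def] by measurable
qed

text \<open>
  Integrating in time first removes the growing kernel \<open>|v - v1|\<close>, so that the velocity weight at \<open>v1\<close> alone
  suffices afterwards: \<open>\<langle>\<beta> v1\<rangle>\<^sup>-\<^sup>q\<close> is integrable for \<open>q > 3\<close>, while with the kernel it would need \<open>q > 4\<close>. The angle
  contributes the area \<open>4 \<pi>\<close> of the sphere.
\<close>

lemma nn_integral_channel_le: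
  "(\<integral>\<^sup>+s. \<integral>\<^sup>+v1. \<integral>\<^sup>+\<sigma>. ennreal (channel l x v s v1 \<sigma>) \<partial>sphere_measure \<partial>lborel \<partial>lborel)
   \<le> ennreal (weight x v * ((if l = 1 then 2 else 1) * 4 * pi\<^sup>2 * p * q / (3 * \<alpha> * (p - 1) * \<beta> ^ 3 * (q - 3))))"
proof -
  interpret S: sigma_finite_measure sphere_measure by (rule sigma_finite_sphere)
  interpret LS: pair_sigma_finite "lborel :: real measure" sphere_measure ..
  let ?m = "if l = 1 then 2 else 1 :: real"
  let ?K = "2 * p / (\<alpha> * (p - 1))"
  have K: "?K \<ge> 0" using p \<alpha> by simp
  have time: "(\<integral>\<^sup>+s. ennreal (channel l x v s v1 \<sigma>) \<partial>lborel)
      \<le> ennreal (weight x v / 8 * ?m * ?K) * ennreal (jap (\<beta> *\<^sub>R v1) powr - q)" if "norm \<sigma> = 1" for v1 \<sigma>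
  proof -
    let ?c = "weight x v / 8 * jap (\<beta> *\<^sub>R v1) powr - q"
    let ?R = "\<lambda>s. if l = 1 then ray x s (v - out_plus v v1 \<sigma>) + ray x s (v - out_minus v v1 \<sigma>) else ray x s (v - v1)"
    have c: "?c \<ge> 0" using weight_pos[of x v] by simp
    have "(\<integral>\<^sup>+s. ennreal (channel l x v s v1 \<sigma>) \<partial>lborel) \<le> (\<integral>\<^sup>+s. ennreal ?c * ennreal (?R s) \<partial>lborel)"
      using c channel_le[OF that] by (intro nn_integral_mono) (simp only: ennreal_leI flip: ennreal_mult')
    also have "\<dots> = ennreal ?c * (\<integral>\<^sup>+s. ennreal (?R s) \<partial>lborel)"
      by (rule nn_integral_cmult) simp
    also have "(\<integral>\<^sup>+s. ennreal (?R s) \<partial>lborel) \<le> ennreal (?m * ?K)"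
    proof (cases "l = 1")
      case True
      have "(\<integral>\<^sup>+s. ennreal (?R s) \<partial>lborel) = (\<integral>\<^sup>+s. ennreal (ray x s (v - out_plus v v1 \<sigma>)) \<partial>lborel) + (\<integral>\<^sup>+s. ennreal (ray x s (v - out_minus v v1 \<sigma>)) \<partial>lborel)"
        using True by (simp add: nn_integral_add)
      also have "\<dots> \<le> ennreal ?K + ennreal ?K"
        by (intro add_mono dispersive_integral_le p \<alpha>)
      finally show ?thesis using True K by (simp flip: ennreal_plus)
    next
      case False
      then show ?thesis using dispersive_integral_le[OF p \<alpha>, of "v - v1" x] by simp
    qed
    also have "ennreal ?c * ennreal (?m * ?K) = ennreal (weight x v / 8 * ?m * ?K) * ennreal (jap (\<beta> *\<^sub>R v1) powr - q)"
      using K weight_pos[of x v] p \<alpha> by (simp flip: ennreal_mult add: mult_ac)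
    finally show ?thesis by (simp add: mult_left_mono)
  qed
  have "(\<integral>\<^sup>+s. \<integral>\<^sup>+v1. \<integral>\<^sup>+\<sigma>. ennreal (channel l x v s v1 \<sigma>) \<partial>sphere_measure \<partial>lborel \<partial>lborel)
    = (\<integral>\<^sup>+v1. \<integral>\<^sup>+s. \<integral>\<^sup>+\<sigma>. ennreal (channel l x v s v1 \<sigma>) \<partial>sphere_measure \<partial>lborel \<partial>lborel)"
    by (rule lborel_pair.Fubini'[symmetric]) measurable
  also have "\<dots> = (\<integral>\<^sup>+v1. \<integral>\<^sup>+\<sigma>. \<integral>\<^sup>+s. ennreal (channel l x v s v1 \<sigma>) \<partial>lborel \<partial>sphere_measure \<partial>lborel)"
    by (intro nn_integral_cong LS.Fubini'[symmetric]) measurable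
  also have "\<dots> \<le> (\<integral>\<^sup>+v1. \<integral>\<^sup>+\<sigma>. ennreal (weight x v / 8 * ?m * ?K) * ennreal (jap (\<beta> *\<^sub>R v1) powr - q) \<partial>sphere_measure \<partial>lborel)"
    by (rule nn_integral_mono, rule nn_integral_mono_AE, rule eventually_mono[OF AE_sphere_measure], rule time)
  also have "\<dots> = ennreal (weight x v / 8 * ?m * ?K) * ennreal (4 * pi) * (\<integral>\<^sup>+v1. ennreal (jap (\<beta> *\<^sub>R v1) powr - q) \<partial>lborel)"
    by (simp add: emeasure_sphere_measure_UNIV nn_integral_cmult nn_integral_multc mult_ac)
  also have "\<dots> \<le> ennreal (weight x v / 8 * ?m * ?K) * ennreal (4 * pi) * ennreal (4 * pi / (3 * \<beta> ^ 3) * q / (q - 3))"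
    by (intro mult_left_mono velocity_integral_le q \<beta>) simp
  also have "\<dots> = ennreal (weight x v / 8 * ?m * ?K * (4 * pi) * (4 * pi / (3 * \<beta> ^ 3) * q / (q - 3)))"
    using K weight_pos[of x v] p \<alpha> q \<beta> by (simp flip: ennreal_mult)
  also have "weight x v / 8 * ?m * ?K * (4 * pi) * (4 * pi / (3 * \<beta> ^ 3) * q / (q - 3)) =
     weight x v * (?m * 4 * pi\<^sup>2 * p * q / (3 * \<alpha> * (p - 1) * \<beta> ^ 3 * (q - 3)))"
  proof -
    have "w / 8 * m * (2 * p / (\<alpha> * P)) * (4 * pi) * (4 * pi / (3 * B) * q / Q) =
        w * (m * 4 * pi\<^sup>2 * p * q / (3 * \<alpha> * P * B * Q))" for w m P Q B :: real
      by (simp add: power2_eq_square mult_ac)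
    then show ?thesis .
  qed
  finally show ?thesis .
qed

lemma C_const_pos: "C_const p q \<alpha> \<beta> > 0"
  using p q \<alpha> \<beta> by (auto simp: C_const_def less_max_iff_disj intro!: mult_pos_pos divide_pos_pos add_pos_pos)

lemma powr_minus_3_le: "1 / \<beta> ^ 3 \<le> max (\<beta> powr q) (\<beta> powr (- 3 * q))"
proof (cases "\<beta> \<ge> 1")
  case True
  then have "1 / \<beta> ^ 3 \<le> 1" by (simp add: field_simps one_le_power)
  also have "1 \<le> \<beta> powr q" using True q by (simp add: ge_one_powr_ge_zero)
  finally show ?thesis by simp
next
  case False
  have "1 / \<beta> ^ 3 = \<beta> powr (- 3)" using \<beta> by (simp add: powr_minus powr_numeral inverse_eq_divide)
  also have "\<dots> \<le> \<beta> powr (- 3 * q)" using False \<beta> q by (intro powr_mono') auto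
  finally show ?thesis by simp
qed

text \<open>
  The four terms contribute in the proportion \<open>1 : 2 : 1 : 1\<close>, which gives the constant
  \<open>20 \<pi>\<^sup>2 p / (\<alpha> (p - 1)) (1/3 + 1/(q - 3)) \<beta>\<^sup>-\<^sup>3\<close>; it is smaller than \<open>C_const\<close> because \<open>20 < 16 \<pi>\<close> and
  \<open>\<beta>\<^sup>-\<^sup>3 \<le> max \<beta>\<^sup>q \<beta>\<^sup>-\<^sup>3\<^sup>q\<close>.
\<close>

lemma nn_integral_rate_le: "(\<integral>\<^sup>+s. rate x v s \<partial>lborel) \<le> ennreal (C_const p q \<alpha> \<beta> * weight x v)"
proof -
  interpret S: sigma_finite_measure sphere_measure by (rule sigma_finite_sphere)
  define B where "B = 4 * pi\<^sup>2 * p * q / (3 * \<alpha> * (p - 1) * \<beta> ^ 3 * (q - 3))"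
  have B: "B \<ge> 0" using p q \<alpha> \<beta> by (simp add: B_def)
  have "(\<integral>\<^sup>+s. rate x v s \<partial>lborel) =
      (\<Sum>l<4::nat. \<integral>\<^sup>+s. \<integral>\<^sup>+v1. \<integral>\<^sup>+\<sigma>. ennreal (channel l x v s v1 \<sigma>) \<partial>sphere_measure \<partial>lborel \<partial>lborel)"
    unfolding rate_def by (rule nn_integral_sum) measurable
  also have "\<dots> \<le> (\<Sum>l<4::nat. ennreal (weight x v * ((if l = 1 then 2 else 1) * B)))"
    by (intro sum_mono order_trans[OF nn_integral_channel_le]) (simp add: B_def mult_ac)
  also have "\<dots> = ennreal (\<Sum>l<4::nat. weight x v * ((if l = 1 then 2 else 1) * B))"
    using weight_pos[of x v] B by (intro sum_ennreal) auto
  also have "(\<Sum>l<4::nat. weight x v * ((if l = 1 then 2 else 1) * B)) = weight x v * (5 * B)"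
    by (simp add: numeral_eq_Suc algebra_simps)
  also have "weight x v * (5 * B) \<le> C_const p q \<alpha> \<beta> * weight x v"
  proof -
    let ?D = "p / (\<alpha> * (p - 1)) * (1 / 3 + 1 / (q - 3))"
    have D: "?D \<ge> 0" using p q \<alpha> by simp
    have "5 * B = 20 * pi\<^sup>2 * ?D * (1 / \<beta> ^ 3)"
      using p q \<alpha> \<beta> by (simp add: B_def field_simps)
    (* 20 \<le> 48 < 16 * pi leaves room, so pi > 3 is enough. *)
    also have "\<dots> \<le> 16 * pi ^ 3 * ?D * max (\<beta> powr q) (\<beta> powr (- 3 * q))"
    proof (rule mult_mono[OF mult_right_mono[OF _ D] powr_minus_3_le])
      show "20 * pi\<^sup>2 \<le> 16 * pi ^ 3" using pi_gt3 by (simp add: power2_eq_square power3_eq_cube)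
    qed (use mult_nonneg_nonneg[OF _ D, of "16 * pi ^ 3"] \<beta> in auto)
    also have "\<dots> = C_const p q \<alpha> \<beta>" by (simp add: C_const_def)
    finally show ?thesis using weight_pos[of x v] by (simp add: mult.commute mult_right_mono)
  qed
  finally show ?thesis by (simp add: ennreal_leI)
qed

section \<open>A supersolution of the hierarchy\<close>

text \<open>
  The initial value is twice \<open>\<rho> \<phi>\<close>, where \<open>\<phi>\<close> is the weight and \<open>\<rho>\<close> the decay per particle of the solutions; the surplus factor
  \<open>2\<close> per particle is what makes the iteration contract. The coefficient \<open>27 \<rho>\<^sup>3\<close> is the cube of the final
  bound \<open>3 \<rho>\<close> in \<open>majorant_le\<close>.
\<close>

definition majorant :: "real \<Rightarrow> real \<Rightarrow> vec3 \<Rightarrow> vec3 \<Rightarrow> ennreal" where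
  "majorant \<rho> t x v = ennreal (2 * \<rho> * weight x v)
     + (\<integral>\<^sup>+s. ennreal (27 * \<rho> ^ 3) * rate x v s * indicator {0..t} s \<partial>lborel)"

lemma majorant_ge: "majorant \<rho> t x v \<ge> ennreal (2 * \<rho> * weight x v)"
  by (simp add: majorant_def)

lemma majorant_le:
  assumes "\<rho> > 0" "27 * \<rho>\<^sup>2 * C_const p q \<alpha> \<beta> \<le> 1"
  shows "majorant \<rho> t x v \<le> ennreal (3 * \<rho> * weight x v)"
proof -
  have "(\<integral>\<^sup>+s. ennreal (27 * \<rho> ^ 3) * rate x v s * indicator {0..t} s \<partial>lborel)
      \<le> (\<integral>\<^sup>+s. ennreal (27 * \<rho> ^ 3) * rate x v s \<partial>lborel)"
    by (intro nn_integral_mono) (auto simp: indicator_def)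
  also have "\<dots> = ennreal (27 * \<rho> ^ 3) * (\<integral>\<^sup>+s. rate x v s \<partial>lborel)"
    by (rule nn_integral_cmult) simp
  also have "\<dots> \<le> ennreal (27 * \<rho> ^ 3) * ennreal (C_const p q \<alpha> \<beta> * weight x v)"
    by (intro mult_left_mono nn_integral_rate_le) simp
  also have "\<dots> = ennreal (27 * \<rho>\<^sup>2 * C_const p q \<alpha> \<beta> * (\<rho> * weight x v))"
    using assms by (simp add: ennreal_mult'[symmetric] power2_eq_square power3_eq_cube mult_ac)
  also have "\<dots> \<le> ennreal (1 * (\<rho> * weight x v))"
    using assms weight_pos[of x v] by (intro ennreal_leI mult_right_mono) auto
  finally have "majorant \<rho> t x v \<le> ennreal (2 * \<rho> * weight x v) + ennreal (\<rho> * weight x v)"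
    unfolding majorant_def by (intro add_left_mono) simp
  also have "\<dots> = ennreal (3 * \<rho> * weight x v)"
    using assms weight_pos[of x v] by (subst ennreal_plus[symmetric]) (auto simp: algebra_simps)
  finally show ?thesis .
qed

lemma borel_measurable_majorant[measurable]: "(\<lambda>t. majorant \<rho> t x v) \<in> borel_measurable borel"
  unfolding majorant_def indicator_def atLeastAtMost_iff by measurable

text \<open>
  The sum over \<open>j\<close> is the derivative of a product, so its integral is the increment of that product: this
  is the step that replaces \<open>k\<close> separate estimates by one.
\<close>

lemma majorant_supersolution:
  fixes X V :: config
  shows "(\<integral>\<^sup>+s. (\<Sum>j=1..k. (ennreal (27 * \<rho> ^ 3) * rate (X j) (V j) s) *
      (\<Prod>i\<in>{1..k} - {j}. majorant \<rho> s (X i) (V i))) * indicator {0..t} s \<partial>lborel)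
   \<le> (\<Prod>i=1..k. majorant \<rho> t (X i) (V i))"
proof -
  have "(\<Prod>i=1..k. majorant \<rho> t (X i) (V i)) = (\<Prod>i=1..k. ennreal (2 * \<rho> * weight (X i) (V i))) +
    (\<integral>\<^sup>+s. (\<Sum>j=1..k. (ennreal (27 * \<rho> ^ 3) * rate (X j) (V j) s) *
      (\<Prod>i\<in>{1..k} - {j}. majorant \<rho> s (X i) (V i))) * indicator {0..t} s \<partial>lborel)"
    unfolding majorant_def by (rule prod_of_integrals) auto
  then show ?thesis by (simp add: le_add2)
qed

text \<open>
  The comparison is with \<open>M 2\<^sup>-\<^sup>(\<^sup>k\<^sup>+\<^sup>2\<^sup>n\<^sup>) U\<^sup>\<otimes>\<^sup>k\<close>, where \<open>U\<close> is the majorant. The case \<open>n = 0\<close> is the a priori bound. One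
  use of the Duhamel inequality bounds level \<open>k\<close> through level \<open>k + 2\<close>; the exponent \<open>k + 2 + 2 n\<close> of that level is
  exactly \<open>k + 2 (n + 1)\<close>, and the supersolution property reproduces \<open>U\<^sup>\<otimes>\<^sup>k\<close>.
\<close>

theorem dominated_hierarchy_vanishes:
  fixes D :: "real \<Rightarrow> nat \<Rightarrow> config \<Rightarrow> config \<Rightarrow> ennreal"
  assumes \<rho>: "\<rho> > 0" "27 * \<rho>\<^sup>2 * C_const p q \<alpha> \<beta> \<le> 1" and M: "M \<ge> 0"
    and bound: "\<And>t k X V. t \<in> {0..T} \<Longrightarrow> k \<ge> 1 \<Longrightarrow> X \<in> space (conf k) \<Longrightarrow> V \<in> space (conf k) \<Longrightarrow>
        D t k X V \<le> ennreal (M * \<rho> ^ k * (\<Prod>i=1..k. weight (X i) (V i)))"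
    and duhamel: "\<And>t k X V. t \<in> {0..T} \<Longrightarrow> k \<ge> 1 \<Longrightarrow> X \<in> space (conf k) \<Longrightarrow> V \<in> space (conf k) \<Longrightarrow>
        D t k X V \<le> (\<Sum>j=1..k. \<Sum>l<4. \<integral>\<^sup>+s. indicator {0..t} s * (\<integral>\<^sup>+v1. \<integral>\<^sup>+\<sigma>.
           ennreal (norm (V j - v1) / 8) * D s (k + 2) (fan_pos l j k X V s v1 \<sigma>) (fan_vel l j k V v1 \<sigma>)
           \<partial>sphere_measure \<partial>lborel) \<partial>lborel)"
    and t: "t \<in> {0..T}" and k: "k \<ge> 1" and X: "X \<in> space (conf k)" and V: "V \<in> space (conf k)"
  shows "D t k X V = 0"
proof -
  interpret S: sigma_finite_measure sphere_measure by (rule sigma_finite_sphere)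
  have iter: "D t k X V \<le> ennreal (M * (1 / 2) ^ (k + 2 * n)) * (\<Prod>i=1..k. majorant \<rho> t (X i) (V i))"
    if "t \<in> {0..T}" "k \<ge> 1" "X \<in> space (conf k)" "V \<in> space (conf k)" for n t k X V
    using that
  proof (induction n arbitrary: t k X V)
    case 0
    have "D t k X V \<le> ennreal (M * \<rho> ^ k * (\<Prod>i=1..k. weight (X i) (V i)))"
      by (rule bound) (use 0 in auto)
    also have "\<dots> = ennreal (M * (1 / 2) ^ k) * ennreal (\<Prod>i=1..k. 2 * \<rho> * weight (X i) (V i))"
      using M by (simp add: ennreal_mult'[symmetric] prod.distrib power_mult_distrib power_divide field_simps)
    also have "ennreal (\<Prod>i=1..k. 2 * \<rho> * weight (X i) (V i)) = (\<Prod>i=1..k. ennreal (2 * \<rho> * weight (X i) (V i)))"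
      using \<rho> weight_pos by (intro prod_ennreal[symmetric]) (simp add: less_imp_le)
    also have "\<dots> \<le> (\<Prod>i=1..k. majorant \<rho> t (X i) (V i))"
      by (intro prod_mono_ennreal) (simp add: majorant_ge)
    finally show ?case by (simp add: mult_left_mono)
  next
    case (Suc n)
    define c where "c = ennreal (M * (1 / 2) ^ (k + 2 * Suc n))"
    define P where "P j s = (\<Prod>i\<in>{1..k} - {j}. majorant \<rho> s (X i) (V i))" for j s
    define a where "a = ennreal (27 * \<rho> ^ 3)"
    define R where "R l j s = (\<integral>\<^sup>+v1. \<integral>\<^sup>+\<sigma>. ennreal (channel l (X j) (V j) s v1 \<sigma>) \<partial>sphere_measure \<partial>lborel)" for l j s
    have rate_R: "rate (X j) (V j) s = (\<Sum>l<4. R l j s)" for j s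
      by (simp add: rate_def R_def)
    have [measurable]: "P j \<in> borel_measurable borel" "R l j \<in> borel_measurable borel" for l j
      unfolding P_def[abs_def] R_def[abs_def] by measurable
    (* The spectators keep the time-dependent majorant, because the Leibniz rule needs it; only the
       three colliding particles are estimated by 3 * \<rho> * weight. *)
    have fan: "ennreal (norm (V j - v1) / 8) * D s (k + 2) (fan_pos l j k X V s v1 \<sigma>) (fan_vel l j k V v1 \<sigma>)
       \<le> c * P j s * a * ennreal (channel l (X j) (V j) s v1 \<sigma>)"
      if j: "j \<in> {1..k}" and s: "s \<in> {0..t}" for j l s v1 \<sigma>
    proof -
      let ?w = "\<lambda>u. weight (X j + s *\<^sub>R (V j - u)) u" and ?m = "\<lambda>u. majorant \<rho> s (X j + s *\<^sub>R (V j - u)) u"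
      let ?a = "slot1 l (V j) v1" and ?b = "slot2 l (V j) v1 \<sigma>" and ?d = "slot3 l (V j) v1 \<sigma>"
      have "D s (k + 2) (fan_pos l j k X V s v1 \<sigma>) (fan_vel l j k V v1 \<sigma>)
         \<le> c * (\<Prod>i=1..k+2. majorant \<rho> s (fan_pos l j k X V s v1 \<sigma> i) (fan_vel l j k V v1 \<sigma> i))"
        using Suc.IH[of s "k + 2"] Suc.prems s fan_in_space[OF j] by (simp add: c_def)
      also have "\<dots> = c * (P j s * (?m ?a * ?m ?b * ?m ?d))"
        unfolding prod_fan[OF j] P_def ..
      also have "\<dots> \<le> c * (P j s * (ennreal (3 * \<rho> * ?w ?a) * ennreal (3 * \<rho> * ?w ?b) * ennreal (3 * \<rho> * ?w ?d)))"
        by (intro mult_left_mono mult_mono majorant_le \<rho>) auto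
      also have "ennreal (3 * \<rho> * ?w ?a) * ennreal (3 * \<rho> * ?w ?b) * ennreal (3 * \<rho> * ?w ?d)
         = a * ennreal (?w ?a * ?w ?b * ?w ?d)"
        using \<rho> weight_pos by (simp add: a_def ennreal_mult'[symmetric] less_imp_le power3_eq_cube mult_ac)
      finally have "ennreal (norm (V j - v1) / 8) * D s (k + 2) (fan_pos l j k X V s v1 \<sigma>) (fan_vel l j k V v1 \<sigma>)
        \<le> ennreal (norm (V j - v1) / 8) * (c * (P j s * (a * ennreal (?w ?a * ?w ?b * ?w ?d))))"
        by (rule mult_left_mono) simp
      also have "\<dots> = c * P j s * a * (ennreal (norm (V j - v1) / 8) * ennreal (?w ?a * ?w ?b * ?w ?d))"
        by (simp add: mult_ac)
      also have "ennreal (norm (V j - v1) / 8) * ennreal (?w ?a * ?w ?b * ?w ?d) = ennreal (channel l (X j) (V j) s v1 \<sigma>)"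
        unfolding channel_def by (rule ennreal_mult'[symmetric]) simp
      finally show ?thesis .
    qed
    have "D t k X V \<le> (\<Sum>j=1..k. \<Sum>l<4. \<integral>\<^sup>+s. indicator {0..t} s * (\<integral>\<^sup>+v1. \<integral>\<^sup>+\<sigma>.
           ennreal (norm (V j - v1) / 8) * D s (k + 2) (fan_pos l j k X V s v1 \<sigma>) (fan_vel l j k V v1 \<sigma>)
           \<partial>sphere_measure \<partial>lborel) \<partial>lborel)"
      by (rule duhamel) (use Suc.prems in auto)
    also have "\<dots> \<le> (\<Sum>j=1..k. \<Sum>l<4. \<integral>\<^sup>+s. c * (a * R l j s * P j s * indicator {0..t} s) \<partial>lborel)"
    proof (intro sum_mono nn_integral_mono)
      fix j l s assume j: "j \<in> {1..k}"
      show "indicator {0..t} s * (\<integral>\<^sup>+v1. \<integral>\<^sup>+\<sigma>.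
           ennreal (norm (V j - v1) / 8) * D s (k + 2) (fan_pos l j k X V s v1 \<sigma>) (fan_vel l j k V v1 \<sigma>)
           \<partial>sphere_measure \<partial>lborel) \<le> c * (a * R l j s * P j s * indicator {0..t} s)"
      proof (cases "s \<in> {0..t}")
        case True
        have "(\<integral>\<^sup>+v1. \<integral>\<^sup>+\<sigma>.
           ennreal (norm (V j - v1) / 8) * D s (k + 2) (fan_pos l j k X V s v1 \<sigma>) (fan_vel l j k V v1 \<sigma>)
           \<partial>sphere_measure \<partial>lborel) \<le> (\<integral>\<^sup>+v1. \<integral>\<^sup>+\<sigma>. c * P j s * a * ennreal (channel l (X j) (V j) s v1 \<sigma>)
           \<partial>sphere_measure \<partial>lborel)"
          by (intro nn_integral_mono fan j True)
        also have "\<dots> = c * P j s * a * R l j s"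
          unfolding R_def by (simp add: nn_integral_cmult)
        finally show ?thesis using True by (simp add: mult_ac)
      qed simp
    qed
    also have "\<dots> = (\<integral>\<^sup>+s. (\<Sum>j=1..k. \<Sum>l<4. c * (a * R l j s * P j s * indicator {0..t} s)) \<partial>lborel)"
      by (simp add: nn_integral_sum)
    also have "\<dots> = (\<integral>\<^sup>+s. c * ((\<Sum>j=1..k. (a * rate (X j) (V j) s) * P j s) * indicator {0..t} s) \<partial>lborel)"
      by (simp only: rate_R sum_distrib_left sum_distrib_right)
    also have "\<dots> = c * (\<integral>\<^sup>+s. (\<Sum>j=1..k. (a * rate (X j) (V j) s) * P j s) * indicator {0..t} s \<partial>lborel)"
      by (rule nn_integral_cmult) simp
    also have "\<dots> \<le> c * (\<Prod>i=1..k. majorant \<rho> t (X i) (V i))"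
      unfolding a_def P_def by (intro mult_left_mono majorant_supersolution) simp
    finally show ?case by (simp add: c_def)
  qed
  define B where "B = (\<Prod>i=1..k. 3 * \<rho> * weight (X i) (V i))"
  have B: "B \<ge> 0" using \<rho> weight_pos by (auto simp: B_def less_imp_le intro!: prod_nonneg)
  have le: "D t k X V \<le> ennreal (M * B * (1 / 2) ^ n)" for n
  proof -
    have "D t k X V \<le> ennreal (M * (1 / 2) ^ (k + 2 * n)) * (\<Prod>i=1..k. majorant \<rho> t (X i) (V i))"
      by (rule iter[OF t k X V])
    also have "(\<Prod>i=1..k. majorant \<rho> t (X i) (V i)) \<le> (\<Prod>i=1..k. ennreal (3 * \<rho> * weight (X i) (V i)))"
      by (intro prod_mono_ennreal) (simp add: majorant_le \<rho>)
    also have "\<dots> = ennreal B"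
      unfolding B_def using \<rho> weight_pos by (intro prod_ennreal) (simp add: less_imp_le)
    also have "ennreal (M * (1 / 2) ^ (k + 2 * n)) * ennreal B \<le> ennreal (M * (1 / 2) ^ n) * ennreal B"
      using M by (intro mult_right_mono ennreal_leI mult_left_mono power_decreasing) auto
    also have "\<dots> = ennreal (M * B * (1 / 2) ^ n)"
      using M B by (simp add: ennreal_mult'[symmetric] mult_ac)
    finally show ?thesis by (simp add: mult_left_mono)
  qed
  have "(\<lambda>n. ennreal (M * B * (1 / 2) ^ n)) \<longlonglongrightarrow> ennreal (M * B * 0)"
    by (intro tendsto_ennrealI tendsto_mult tendsto_const LIMSEQ_power_zero) simp
  then have "D t k X V \<le> ennreal (M * B * 0)"
    using le by (intro LIMSEQ_le_const) auto
  then show ?thesis by simp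
qed

section \<open>The Duhamel inequality for the difference of two solutions\<close>

text \<open>
  The pointwise form of \<open>XX_norm p q \<alpha> \<beta> \<mu> G \<le> M\<close>. It is the form in which the norm enters the
  estimates below, and it makes the triangle inequality immediate.
\<close>

definition dominated :: "real \<Rightarrow> real \<Rightarrow> hierarchy \<Rightarrow> bool" where
  "dominated M \<mu> G \<longleftrightarrow> (\<forall>k\<ge>1. \<forall>X\<in>space (conf k). \<forall>V\<in>space (conf k).
     \<bar>G k X V\<bar> \<le> M * exp (- \<mu>) ^ k * (\<Prod>i=1..k. weight (X i) (V i)))"

lemma dominatedD:
  "dominated M \<mu> G \<Longrightarrow> k \<ge> 1 \<Longrightarrow> X \<in> space (conf k) \<Longrightarrow> V \<in> space (conf k) \<Longrightarrow>
     \<bar>G k X V\<bar> \<le> M * exp (- \<mu>) ^ k * (\<Prod>i=1..k. weight (X i) (V i))"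
  by (simp add: dominated_def)

lemma dominated_if_XX_norm_le:
  assumes "XX_norm p q \<alpha> \<beta> \<mu> G \<le> ennreal M" and "M \<ge> 0"
  shows "dominated M \<mu> G"
  unfolding dominated_def
proof (intro allI impI ballI)
  fix k :: nat and X V assume k: "k \<ge> 1" and XV: "X \<in> space (conf k)" "V \<in> space (conf k)"
  define A where "A = japs k (\<lambda>i. \<alpha> *\<^sub>R X i) powr p * japs k (\<lambda>i. \<beta> *\<^sub>R V i) powr q"
  have japs_pos: "japs k Y > 0" for Y unfolding japs_def by (intro prod_pos) simp
  have A: "A > 0" using japs_pos by (auto simp: A_def less_le)
  have w: "(\<Prod>i=1..k. weight (X i) (V i)) = 1 / A"
    unfolding A_def weight_def japs_def
    by (simp add: prod.distrib prod_dividef powr_minus_divide prod_powr_distrib less_imp_le)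
  have "ennreal (exp (\<mu> * real k)) * ennreal (A * \<bar>G k X V\<bar>) \<le> XX_norm p q \<alpha> \<beta> \<mu> G"
    unfolding XX_norm_def X_norm_def A_def
    by (rule SUP_upper2[of k], use k in simp, intro mult_left_mono, rule SUP_upper2[OF XV(1)], rule SUP_upper2[OF XV(2)]) auto
  then have "ennreal (exp (\<mu> * real k) * (A * \<bar>G k X V\<bar>)) \<le> ennreal M"
    using assms by (simp add: ennreal_mult')
  then have "exp (\<mu> * real k) * (A * \<bar>G k X V\<bar>) \<le> M" using assms by (simp add: ennreal_le_iff)
  then have "\<bar>G k X V\<bar> \<le> M / (exp (\<mu> * real k) * A)"
    using A by (simp add: pos_le_divide_eq mult_ac)
  also have "\<dots> = M * exp (- \<mu>) ^ k * (1 / A)"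
    by (simp add: exp_of_nat_mult[symmetric] exp_minus field_simps)
  finally show "\<bar>G k X V\<bar> \<le> M * exp (- \<mu>) ^ k * (\<Prod>i=1..k. weight (X i) (V i))"
    unfolding w .
qed

lemma dominated_add:
  assumes "dominated M \<mu> G" "dominated N \<mu> (\<lambda>k X V. H k X V - G k X V)"
  shows "dominated (M + N) \<mu> H"
  unfolding dominated_def
proof (intro allI impI ballI)
  fix k :: nat and X V assume k: "k \<ge> 1" and XV: "X \<in> space (conf k)" "V \<in> space (conf k)"
  have "\<bar>H k X V\<bar> \<le> \<bar>G k X V\<bar> + \<bar>H k X V - G k X V\<bar>" by linarith
  also have "\<dots> \<le> M * exp (- \<mu>) ^ k * (\<Prod>i=1..k. weight (X i) (V i)) + N * exp (- \<mu>) ^ k * (\<Prod>i=1..k. weight (X i) (V i))"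
    using assms k XV unfolding dominated_def by (intro add_mono) auto
  finally show "\<bar>H k X V\<bar> \<le> (M + N) * exp (- \<mu>) ^ k * (\<Prod>i=1..k. weight (X i) (V i))"
    by (simp add: algebra_simps)
qed

lemma dominated_mono:
  assumes "dominated M \<mu> G" "M \<le> N"
  shows "dominated N \<mu> G"
  unfolding dominated_def
proof (intro allI impI ballI)
  fix k :: nat and X V assume k: "k \<ge> 1" and XV: "X \<in> space (conf k)" "V \<in> space (conf k)"
  have "\<bar>G k X V\<bar> \<le> M * exp (- \<mu>) ^ k * (\<Prod>i=1..k. weight (X i) (V i))"
    using assms k XV unfolding dominated_def by auto
  also have "\<dots> \<le> N * exp (- \<mu>) ^ k * (\<Prod>i=1..k. weight (X i) (V i))"
    using assms(2) weight_pos by (intro mult_right_mono prod_nonneg) (auto simp: less_imp_le)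
  finally show "\<bar>G k X V\<bar> \<le> N * exp (- \<mu>) ^ k * (\<Prod>i=1..k. weight (X i) (V i))" .
qed

text \<open>
  Norm continuity gives a bound near every time, and finitely many such neighbourhoods cover \<open>[0,T]\<close>.
\<close>

lemma curve_dominated:
  assumes "H \<in> XXT_space p q \<alpha> \<beta> \<mu> T"
  obtains M where "M \<ge> 0" "\<And>t. t \<in> {0..T} \<Longrightarrow> dominated M \<mu> (H t)"
proof -
  have local: "\<exists>M d. M \<ge> 0 \<and> d > 0 \<and> (\<forall>s\<in>{0..T}. dist s t < d \<longrightarrow> dominated M \<mu> (H s))"
    if t: "t \<in> {0..T}" for t
  proof -
    have "XX_norm p q \<alpha> \<beta> \<mu> (H t) < \<infinity>"
      using assms t by (auto simp: XXT_space_def XX_space_def)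
    then obtain m where m: "XX_norm p q \<alpha> \<beta> \<mu> (H t) = ennreal m" "m \<ge> 0"
      by (cases "XX_norm p q \<alpha> \<beta> \<mu> (H t)") auto
    have dt: "dominated m \<mu> (H t)" by (rule dominated_if_XX_norm_le) (use m in auto)
    have "((\<lambda>s. XX_norm p q \<alpha> \<beta> \<mu> (\<lambda>k X V. H s k X V - H t k X V)) \<longlongrightarrow> 0) (at t within {0..T})"
      using assms t by (auto simp: XXT_space_def)
    (* Norm distance 1 from the curve at time t raises the bound by 1. *)
    then have "\<forall>\<^sub>F s in at t within {0..T}. XX_norm p q \<alpha> \<beta> \<mu> (\<lambda>k X V. H s k X V - H t k X V) < 1"
      by (rule order_tendstoD) simp
    then obtain d where d: "d > 0" "\<And>s. s \<in> {0..T} \<Longrightarrow> s \<noteq> t \<Longrightarrow> dist s t < d \<Longrightarrow>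
        XX_norm p q \<alpha> \<beta> \<mu> (\<lambda>k X V. H s k X V - H t k X V) < 1"
      unfolding eventually_at by blast
    have "dominated (m + 1) \<mu> (H s)" if s: "s \<in> {0..T}" "dist s t < d" for s
    proof (cases "s = t")
      case True
      then show ?thesis using dominated_mono[OF dt, of "m + 1"] by simp
    next
      case False
      have "dominated 1 \<mu> (\<lambda>k X V. H s k X V - H t k X V)"
        using d(2)[OF s(1) False s(2)] by (intro dominated_if_XX_norm_le) auto
      then show ?thesis by (rule dominated_add[OF dt])
    qed
    then show ?thesis using m(2) d(1) by (intro exI[of _ "m + 1"] exI[of _ d]) auto
  qed
  then obtain M d where Md: "\<And>t. t \<in> {0..T} \<Longrightarrow> M t \<ge> 0 \<and> d t > 0 \<and>
      (\<forall>s\<in>{0..T}. dist s t < d t \<longrightarrow> dominated (M t) \<mu> (H s))" by metis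
  obtain C where C: "C \<subseteq> {0..T}" "finite C" "{0..T} \<subseteq> (\<Union>t\<in>C. ball t (d t))"
  proof (rule compactE_image[of "{0..T}" "{0..T}" "\<lambda>t. ball t (d t)"])
    show "{0..T} \<subseteq> (\<Union>c\<in>{0..T}. ball c (d c))" using Md by fastforce
  qed auto
  show thesis
  proof
    show "(\<Sum>t\<in>C. M t) \<ge> 0" using C(1) Md by (intro sum_nonneg) auto
    fix s assume s: "s \<in> {0..T}"
    then obtain t where t: "t \<in> C" "dist s t < d t" using C(3) by (auto simp: dist_commute)
    have "dominated (M t) \<mu> (H s)" using Md t s C(1) by blast
    moreover have "M t \<le> (\<Sum>t\<in>C. M t)" using C(1,2) Md t(1) by (intro member_le_sum) auto
    ultimately show "dominated (\<Sum>t\<in>C. M t) \<mu> (H s)" by (rule dominated_mono)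
  qed
qed

text \<open>
  The bound on the solution and the time-integrated channel bound give absolute integrability in time, velocity
  and angle together. By Fubini the collision integrals then converge at almost every time, which justifies both
  splitting the collision operator into its terms and subtracting two solutions.
\<close>

lemma branch_integrable:
  assumes sol: "mild_solution p q \<alpha> \<beta> \<mu> T F0 F"
    and t: "t \<in> {0..T}" and k: "k \<ge> 1" and j: "j \<in> {1..k}" and XV: "X \<in> space (conf k)" "V \<in> space (conf k)"
  shows "integrable (lborel \<Otimes>\<^sub>M (lborel \<Otimes>\<^sub>M sphere_measure))
     (\<lambda>(s, v1, \<sigma>). indicator {0..t} s * branch l j k F X V s v1 \<sigma>)"
proof (rule integrableI_bounded)
  interpret S: sigma_finite_measure sphere_measure by (rule sigma_finite_sphere)
  have F: "(\<lambda>(t, X, V). F t (k + 2) X V) \<in>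
        borel_measurable (restrict_space borel {0..T} \<Otimes>\<^sub>M (conf (k + 2) \<Otimes>\<^sub>M conf (k + 2)))"
    using sol k by (auto simp: mild_solution_def)
  have curve: "(\<lambda>t k. transport k (- t) (F t k)) \<in> XXT_space p q \<alpha> \<beta> \<mu> T"
    using sol by (auto simp: mild_solution_def)
  obtain M where M: "M \<ge> 0" "\<And>t. t \<in> {0..T} \<Longrightarrow> dominated M \<mu> (\<lambda>k. transport k (- t) (F t k))"
    using curve_dominated[OF curve] by blast
  let ?N = "lborel \<Otimes>\<^sub>M (lborel \<Otimes>\<^sub>M sphere_measure) :: (real \<times> vec3 \<times> vec3) measure"
  define A where "A = M * exp (- \<mu>) ^ (k + 2) * (\<Prod>i\<in>{1..k} - {j}. weight (X i) (V i))"
  have A: "A \<ge> 0" using M(1) weight_pos by (auto simp: A_def less_imp_le intro!: mult_nonneg_nonneg prod_nonneg)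
  show meas: "(\<lambda>(s, v1, \<sigma>). indicator {0..t} s * branch l j k F X V s v1 \<sigma>) \<in> borel_measurable ?N"
    by (rule borel_measurable_branch[where F = F and k = k and T = T, OF F t j XV(2)])
  have le: "\<bar>indicator {0..t} s * branch l j k F X V s v1 \<sigma>\<bar> \<le> A * channel l (X j) (V j) s v1 \<sigma>" for s v1 \<sigma>
  proof (cases "s \<in> {0..t}")
    case True
    then have "dominated M \<mu> (\<lambda>k. transport k (- s) (F s k))" using t by (intro M(2)) auto
    then have "\<bar>transport (k + 2) (- s) (F s (k + 2)) (fan_pos l j k X V s v1 \<sigma>) (fan_vel l j k V v1 \<sigma>)\<bar>
      \<le> M * exp (- \<mu>) ^ (k + 2) * (\<Prod>i=1..k+2. weight (fan_pos l j k X V s v1 \<sigma> i) (fan_vel l j k V v1 \<sigma> i))"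
      by (rule dominatedD) (use fan_in_space[OF j] XV in auto)
    also note prod_fan[OF j]
    finally have "norm (V j - v1) / 8 * \<bar>transport (k + 2) (- s) (F s (k + 2)) (fan_pos l j k X V s v1 \<sigma>) (fan_vel l j k V v1 \<sigma>)\<bar>
      \<le> norm (V j - v1) / 8 * (M * exp (- \<mu>) ^ (k + 2) * ((\<Prod>i\<in>{1..k} - {j}. weight (X i) (V i)) *
     (weight (X j + s *\<^sub>R (V j - slot1 l (V j) v1)) (slot1 l (V j) v1) *
      weight (X j + s *\<^sub>R (V j - slot2 l (V j) v1 \<sigma>)) (slot2 l (V j) v1 \<sigma>) *
      weight (X j + s *\<^sub>R (V j - slot3 l (V j) v1 \<sigma>)) (slot3 l (V j) v1 \<sigma>))))"
      by (rule mult_left_mono) simp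
    then show ?thesis using True
      by (simp add: branch_moving_frame[OF j] abs_mult A_def channel_def mult_ac)
  qed (use A channel_nonneg in simp)
  have "(\<integral>\<^sup>+w. ennreal (norm (case w of (s, v1, \<sigma>) \<Rightarrow> indicator {0..t} s * branch l j k F X V s v1 \<sigma>)) \<partial>?N)
     \<le> (\<integral>\<^sup>+(s, v1, \<sigma>). ennreal A * ennreal (channel l (X j) (V j) s v1 \<sigma>) \<partial>?N)"
    using le A by (intro nn_integral_mono) (auto simp: ennreal_mult'[symmetric] intro!: ennreal_leI)
  also have "\<dots> = (\<integral>\<^sup>+s. \<integral>\<^sup>+v1. \<integral>\<^sup>+\<sigma>. ennreal A * ennreal (channel l (X j) (V j) s v1 \<sigma>) \<partial>sphere_measure \<partial>lborel \<partial>lborel)"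
    by (rule nn_integral_triple) measurable
  also have "\<dots> = ennreal A * (\<integral>\<^sup>+s. \<integral>\<^sup>+v1. \<integral>\<^sup>+\<sigma>. ennreal (channel l (X j) (V j) s v1 \<sigma>) \<partial>sphere_measure \<partial>lborel \<partial>lborel)"
    by (simp add: nn_integral_cmult)
  also have "\<dots> < \<infinity>"
    using nn_integral_channel_le[of l "X j" "V j"]
    by (simp add: ennreal_mult_less_top) (use le_less_trans ennreal_less_top in blast)
  finally show "(\<integral>\<^sup>+w. ennreal (norm (case w of (s, v1, \<sigma>) \<Rightarrow> indicator {0..t} s * branch l j k F X V s v1 \<sigma>)) \<partial>?N) < \<infinity>" .
qed

text \<open>
  Fubini turns the iterated integrals of the Duhamel formula, whose inner ones are known to converge only at
  almost every time, into one absolutely convergent integral per collision term.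
\<close>

lemma mild_solution_branches:
  assumes sol: "mild_solution p q \<alpha> \<beta> \<mu> T F0 F"
    and t: "t \<in> {0..T}" and k: "k \<ge> 1" and XV: "X \<in> space (conf k)" "V \<in> space (conf k)"
  shows "transport k (- t) (F t k) X V = F0 k X V +
    (\<Sum>j=1..k. \<Sum>l<4. channel_sign l *
      (\<integral>(s, v1, \<sigma>). indicator {0..t} s * branch l j k F X V s v1 \<sigma> \<partial>(lborel \<Otimes>\<^sub>M (lborel \<Otimes>\<^sub>M sphere_measure))))"
proof -
  interpret S: sigma_finite_measure sphere_measure by (rule sigma_finite_sphere)
  interpret LS: pair_sigma_finite "lborel :: vec3 measure" sphere_measure ..
  interpret P: pair_sigma_finite "lborel :: real measure" "lborel \<Otimes>\<^sub>M sphere_measure"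
    by (intro pair_sigma_finite.intro sigma_finite_pair_measure lborel.sigma_finite_measure_axioms sigma_finite_sphere)
  let ?B = "\<lambda>l j (s, v1, \<sigma>). indicator {0..t} s * branch l j k F X V s v1 \<sigma>"
  let ?I = "\<lambda>l j s. \<integral>(v1, \<sigma>). branch l j k F X V s v1 \<sigma> \<partial>(lborel \<Otimes>\<^sub>M sphere_measure)"
  have inner: "(\<integral>w. ?B l j (s, w) \<partial>(lborel \<Otimes>\<^sub>M sphere_measure)) = indicator {0..t} s * ?I l j s" for l j s
    by (subst integral_mult_right_zero[symmetric]) (simp add: case_prod_unfold)
  have int: "integrable lborel (\<lambda>s. indicator {0..t} s * ?I l j s)"
    and eq: "(\<integral>s. indicator {0..t} s * ?I l j s \<partial>lborel) = integral\<^sup>L (lborel \<Otimes>\<^sub>M (lborel \<Otimes>\<^sub>M sphere_measure)) (?B l j)"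
    if j: "j \<in> {1..k}" for l j
    using P.integrable_fst'[OF branch_integrable[OF sol t k j XV, of l]]
      P.integral_fst'[OF branch_integrable[OF sol t k j XV, of l]] unfolding inner by simp_all
  have "transport k (- t) (F t k) X V = F0 k X V +
          (LINT s:{0..t}|lborel. transport k (- s) (collision k (F s (k + 2))) X V)"
    using sol t k XV by (auto simp: mild_solution_def)
  also have "(LINT s:{0..t}|lborel. transport k (- s) (collision k (F s (k + 2))) X V)
     = (\<integral>s. (\<Sum>j=1..k. \<Sum>l<4. channel_sign l * (indicator {0..t} s * ?I l j s)) \<partial>lborel)"
    unfolding set_lebesgue_integral_def transport_collision_eq
    by (intro Bochner_Integration.integral_cong) (simp_all add: sum_distrib_left mult_ac)
  also have "\<dots> = (\<Sum>j=1..k. \<integral>s. (\<Sum>l<4. channel_sign l * (indicator {0..t} s * ?I l j s)) \<partial>lborel)"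
    using int by (intro Bochner_Integration.integral_sum Bochner_Integration.integrable_sum integrable_mult_right) auto
  also have "\<dots> = (\<Sum>j=1..k. \<Sum>l<4. \<integral>s. channel_sign l * (indicator {0..t} s * ?I l j s) \<partial>lborel)"
    using int by (intro sum.cong refl Bochner_Integration.integral_sum integrable_mult_right) auto
  also have "\<dots> = (\<Sum>j=1..k. \<Sum>l<4. channel_sign l * integral\<^sup>L (lborel \<Otimes>\<^sub>M (lborel \<Otimes>\<^sub>M sphere_measure)) (?B l j))"
    by (intro sum.cong refl) (simp add: eq)
  finally show ?thesis .
qed

lemma difference_duhamel:
  assumes F: "mild_solution p q \<alpha> \<beta> \<mu> T F0 F" and G: "mild_solution p q \<alpha> \<beta> \<mu> T F0 G"
  defines "D \<equiv> \<lambda>t k X V. ennreal \<bar>transport k (- t) (F t k) X V - transport k (- t) (G t k) X V\<bar>"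
  assumes t: "t \<in> {0..T}" and k: "k \<ge> 1" and XV: "X \<in> space (conf k)" "V \<in> space (conf k)"
  shows "D t k X V \<le> (\<Sum>j=1..k. \<Sum>l<4. \<integral>\<^sup>+s. indicator {0..t} s * (\<integral>\<^sup>+v1. \<integral>\<^sup>+\<sigma>.
           ennreal (norm (V j - v1) / 8) * D s (k + 2) (fan_pos l j k X V s v1 \<sigma>) (fan_vel l j k V v1 \<sigma>)
           \<partial>sphere_measure \<partial>lborel) \<partial>lborel)"
proof -
  let ?N = "lborel \<Otimes>\<^sub>M (lborel \<Otimes>\<^sub>M sphere_measure) :: (real \<times> vec3 \<times> vec3) measure"
  let ?B = "\<lambda>F l j (s, v1, \<sigma>). indicator {0..t} s * branch l j k F X V s v1 \<sigma>"
  let ?d = "\<lambda>l j s v1 \<sigma>. indicator {0..t} s * branch l j k F X V s v1 \<sigma> - indicator {0..t} s * branch l j k G X V s v1 \<sigma>"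
  let ?R = "\<lambda>l j. \<integral>\<^sup>+s. indicator {0..t} s * (\<integral>\<^sup>+v1. \<integral>\<^sup>+\<sigma>.
           ennreal (norm (V j - v1) / 8) * D s (k + 2) (fan_pos l j k X V s v1 \<sigma>) (fan_vel l j k V v1 \<sigma>)
           \<partial>sphere_measure \<partial>lborel) \<partial>lborel"
  have each: "ennreal \<bar>integral\<^sup>L ?N (?B F l j) - integral\<^sup>L ?N (?B G l j)\<bar> \<le> ?R l j" if j: "j \<in> {1..k}" for l j
  proof -
    note iF = branch_integrable[OF F t k j XV, of l] and iG = branch_integrable[OF G t k j XV, of l]
    have int: "integrable ?N (\<lambda>(s, v1, \<sigma>). ?d l j s v1 \<sigma>)"
      using Bochner_Integration.integrable_diff[OF iF iG] by (simp add: case_prod_unfold)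
    have "integral\<^sup>L ?N (?B F l j) - integral\<^sup>L ?N (?B G l j) = integral\<^sup>L ?N (\<lambda>(s, v1, \<sigma>). ?d l j s v1 \<sigma>)"
      using Bochner_Integration.integral_diff[OF iF iG] by (simp add: case_prod_unfold)
    then have "ennreal \<bar>integral\<^sup>L ?N (?B F l j) - integral\<^sup>L ?N (?B G l j)\<bar>
        \<le> (\<integral>\<^sup>+w. ennreal (norm (case w of (s, v1, \<sigma>) \<Rightarrow> ?d l j s v1 \<sigma>)) \<partial>?N)"
      using integral_norm_bound_ennreal[OF int] by simp
    also have "\<dots> = (\<integral>\<^sup>+(s, v1, \<sigma>). ennreal \<bar>?d l j s v1 \<sigma>\<bar> \<partial>?N)"
      by (intro nn_integral_cong) auto
    also have "\<dots> = (\<integral>\<^sup>+s. \<integral>\<^sup>+v1. \<integral>\<^sup>+\<sigma>. ennreal \<bar>?d l j s v1 \<sigma>\<bar> \<partial>sphere_measure \<partial>lborel \<partial>lborel)"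
      using borel_measurable_integrable[OF int] by (intro nn_integral_triple) (simp add: case_prod_unfold)
    also have "\<dots> = ?R l j"
    proof (rule nn_integral_cong)
      fix s
      show "(\<integral>\<^sup>+v1. \<integral>\<^sup>+\<sigma>. ennreal \<bar>?d l j s v1 \<sigma>\<bar> \<partial>sphere_measure \<partial>lborel) =
        indicator {0..t} s * (\<integral>\<^sup>+v1. \<integral>\<^sup>+\<sigma>.
           ennreal (norm (V j - v1) / 8) * D s (k + 2) (fan_pos l j k X V s v1 \<sigma>) (fan_vel l j k V v1 \<sigma>)
           \<partial>sphere_measure \<partial>lborel)"
      proof (cases "s \<in> {0..t}")
        case True
        have "\<bar>c / 8 * x - c / 8 * y\<bar> = c / 8 * \<bar>x - y\<bar>" if "c \<ge> 0" for c x y :: real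
          using that by (simp add: abs_mult flip: right_diff_distrib diff_divide_distrib)
        then show ?thesis using True
          by (simp only: D_def branch_moving_frame[OF j] indicator_simps mult_1 norm_ge_zero
              ennreal_mult'[symmetric] divide_nonneg_nonneg zero_le_numeral if_True)
      qed simp
    qed
    finally show ?thesis .
  qed
  have "D t k X V = ennreal \<bar>\<Sum>j=1..k. \<Sum>l<4. channel_sign l * (integral\<^sup>L ?N (?B F l j) - integral\<^sup>L ?N (?B G l j))\<bar>"
    unfolding D_def mild_solution_branches[OF F t k XV] mild_solution_branches[OF G t k XV]
    by (simp add: sum_subtractf right_diff_distrib)
  also have "\<dots> \<le> ennreal (\<Sum>j=1..k. \<Sum>l<4. \<bar>integral\<^sup>L ?N (?B F l j) - integral\<^sup>L ?N (?B G l j)\<bar>)"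
    by (intro ennreal_leI order_trans[OF sum_abs] sum_mono order_trans[OF sum_abs])
      (simp add: channel_sign_def abs_mult)
  also have "\<dots> = (\<Sum>j=1..k. \<Sum>l<4. ennreal \<bar>integral\<^sup>L ?N (?B F l j) - integral\<^sup>L ?N (?B G l j)\<bar>)"
    by (simp add: sum_nonneg flip: sum_ennreal)
  also have "\<dots> \<le> (\<Sum>j=1..k. \<Sum>l<4. ?R l j)"
    by (intro sum_mono each)
  finally show ?thesis .
qed

end

section \<open>Uniqueness\<close>

theorem theorem3p4:
  fixes T p q \<alpha> \<beta> \<mu> :: real
    and F0 :: hierarchy
    and F G :: "real \<Rightarrow> hierarchy"
  assumes "T > 0" and "p > 1" and "q > 3" and "\<alpha> > 0" and "\<beta> > 0"
    and "exp (2 * \<mu>) > 32 * C_const p q \<alpha> \<beta>"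
    and "F0 \<in> XX_space p q \<alpha> \<beta> \<mu>"
    and "mild_solution p q \<alpha> \<beta> \<mu> T F0 F"
    and "mild_solution p q \<alpha> \<beta> \<mu> T F0 G"
  shows "\<forall>k\<ge>1. \<forall>t\<in>{0..T}. \<forall>X\<in>space (conf k). \<forall>V\<in>space (conf k). F t k X V = G t k X V"
proof (intro allI impI ballI)
  fix k :: nat and t X V
  assume k: "k \<ge> 1" and t: "t \<in> {0..T}" and XV: "X \<in> space (conf k)" "V \<in> space (conf k)"
  interpret weights p q \<alpha> \<beta> by unfold_locales (use assms in auto)
  define H where "H F t k = transport k (- t) (F t k)" for F :: "real \<Rightarrow> hierarchy" and t k
  define D where "D t k X V = ennreal \<bar>H F t k X V - H G t k X V\<bar>" for t k X V
  have "H F \<in> XXT_space p q \<alpha> \<beta> \<mu> T" "H G \<in> XXT_space p q \<alpha> \<beta> \<mu> T"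
    using assms(8,9) by (simp_all add: mild_solution_def H_def[abs_def])
  then obtain M N where MN: "M \<ge> 0" "N \<ge> 0" and
    dom: "\<And>t. t \<in> {0..T} \<Longrightarrow> dominated M \<mu> (H F t)" "\<And>t. t \<in> {0..T} \<Longrightarrow> dominated N \<mu> (H G t)"
    by (metis curve_dominated)
  have small: "27 * (exp (- \<mu>))\<^sup>2 * C_const p q \<alpha> \<beta> \<le> 1"
  proof -
    have "27 * C_const p q \<alpha> \<beta> \<le> exp (2 * \<mu>)" using assms(6) C_const_pos by linarith
    moreover have "(exp (- \<mu>))\<^sup>2 = 1 / exp (2 * \<mu>)"
      by (simp add: exp_minus power2_eq_square field_simps flip: exp_add)
    ultimately show ?thesis by simp
  qed
  have zero: "D t k X V = 0" if X: "X \<in> space (conf k)" for X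
  proof (rule dominated_hierarchy_vanishes[where T = T and M = "M + N", OF _ small])
    fix t k X V assume *: "t \<in> {0..T}" "1 \<le> k" "X \<in> space (conf k)" "V \<in> space (conf k)"
    have "\<bar>H F t k X V - H G t k X V\<bar> \<le> \<bar>H F t k X V\<bar> + \<bar>H G t k X V\<bar>" by linarith
    also have "\<dots> \<le> M * exp (- \<mu>) ^ k * (\<Prod>i=1..k. weight (X i) (V i)) + N * exp (- \<mu>) ^ k * (\<Prod>i=1..k. weight (X i) (V i))"
      using dom[OF *(1)] * unfolding dominated_def by (intro add_mono) auto
    finally show "D t k X V \<le> ennreal ((M + N) * exp (- \<mu>) ^ k * (\<Prod>i=1..k. weight (X i) (V i)))"
      unfolding D_def by (intro ennreal_leI) (simp add: algebra_simps)
  next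
    fix t k X V assume *: "t \<in> {0..T}" "1 \<le> k" "X \<in> space (conf k)" "V \<in> space (conf k)"
    show "D t k X V \<le> (\<Sum>j=1..k. \<Sum>l<4. \<integral>\<^sup>+s. indicator {0..t} s * (\<integral>\<^sup>+v1. \<integral>\<^sup>+\<sigma>.
           ennreal (norm (V j - v1) / 8) * D s (k + 2) (fan_pos l j k X V s v1 \<sigma>) (fan_vel l j k V v1 \<sigma>)
           \<partial>sphere_measure \<partial>lborel) \<partial>lborel)"
      unfolding D_def H_def by (rule difference_duhamel[OF assms(8,9) *])
  qed (use MN t k X XV in auto)
  (* D compares the solutions at points shifted by t times the velocities, so it is applied at the
     point that this shift moves to X. *)
  let ?Y = "\<lambda>i\<in>{1..k}. X i - t *\<^sub>R V i"
  have "?Y \<in> space (conf k)" by (simp add: space_conf)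
  then have "H F t k ?Y V = H G t k ?Y V" using zero[of ?Y] by (simp add: D_def)
  moreover have "(\<lambda>i\<in>{1..k}. ?Y i - (- t) *\<^sub>R V i) = X"
    using XV(1) by (auto simp: space_conf extensional_def fun_eq_iff)
  ultimately show "F t k X V = G t k X V" by (simp add: H_def transport_def)
qed

end
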